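(* There exists a countable, acyclic MDP $\mathcal{M}$ with initial state $s_0$, whose total reward is implicit in the state, whose transition probabilities are rational, whose transition rewards are in $\{-1,0,1\}$ and in which every state has at most $2$ successors, such that the value of $s_0$ for $\mathit{MP}_{\liminf\ge 0}=\{\rho\mid \liminf_{n\to\infty}\frac1n\sum_{j=0}^{n-1} r(e_j)\ge 0\}$ is $1$, while every finite-memory randomized (FR) strategy $\sigma$ satisfies $\mathcal{P}_{\mathcal{M},s_0,\sigma}(\mathit{MP}_{\liminf\ge 0})=0$. In particular, for every $\varepsilon<1$ there are no $\varepsilon$-optimal strategies using a reward counter plus finite memory for $\mathit{MP}_{\liminf\ge 0}$ in countable MDPs.
   Context: An MDP has a countable set of states partitioned into controlled and random states, a transition relation (every state has a successor), fixed probability distributions over successors at random states, and real rewards on transitions; runs are $s_0e_0s_1e_1\dots$ with transitions $e_j$. It is acyclic if its transition graph has no directed cycle. The total reward is implicit in the state if for every state $s$ all finite paths from $s_0$ to $s$ have the same sum of transition rewards. A strategy assigns to each finite partial run ending in a controlled state a distribution over successors, inducing a probability measure on runs; the value is the supremum of the objective's probability over all strategies; $\varepsilon$-optimal means at least value$-\varepsilon$. FR strategies are those implementable with a finite set of memory modes and (possibly randomized) memory updates and choices depending on the current mode and state. A reward counter plus finite memory strategy bases its choices on the current state, the sum of rewards seen so far, and finitely many memory modes. *)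

theory Defs
  imports "HOL-Probability.Probability"
begin

record 's mdp =
  controlled :: "'s set"
  random_states :: "'s set"
  edges :: "('s \<times> 's) set"
  succ_dist :: "'s \<Rightarrow> 's pmf"
  reward :: "'s \<Rightarrow> 's \<Rightarrow> real"

definition states :: "'s mdp \<Rightarrow> 's set" where
  "states M = controlled M \<union> random_states M"

definition successors :: "'s mdp \<Rightarrow> 's \<Rightarrow> 's set" where
  "successors M s = {t. (s, t) \<in> edges M}"

definition mdp :: "'s mdp \<Rightarrow> bool" where
  "mdp M \<longleftrightarrow>
     countable (states M) \<and>
     controlled M \<inter> random_states M = {} \<and>
     edges M \<subseteq> states M \<times> states M \<and>
     (\<forall>s\<in>states M. successors M s \<noteq> {}) \<and>
     (\<forall>s\<in>random_states M. set_pmf (succ_dist M s) \<subseteq> successors M s)"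


subsection \<open>Runs and partial runs\<close>

text \<open>Transitions are pairs of states, so a run is determined by its sequence of states, and
  a partial run by a non-empty list of states.\<close>

definition runs :: "'s mdp \<Rightarrow> 's \<Rightarrow> (nat \<Rightarrow> 's) set" where
  "runs M s0 = {\<rho>. \<rho> 0 = s0 \<and> (\<forall>i. (\<rho> i, \<rho> (Suc i)) \<in> edges M)}"

definition partial_runs :: "'s mdp \<Rightarrow> 's list set" where
  "partial_runs M =
     {h. h \<noteq> [] \<and> set h \<subseteq> states M \<and> (\<forall>i. Suc i < length h \<longrightarrow> (h ! i, h ! Suc i) \<in> edges M)}"

definition total_reward :: "'s mdp \<Rightarrow> 's list \<Rightarrow> real" where
  "total_reward M h = (\<Sum>i<length h - 1. reward M (h ! i) (h ! Suc i))"

definition implicit_total_reward :: "'s mdp \<Rightarrow> 's \<Rightarrow> bool" where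
  "implicit_total_reward M s0 \<longleftrightarrow>
     (\<forall>g\<in>partial_runs M. \<forall>h\<in>partial_runs M.
        hd g = s0 \<and> hd h = s0 \<and> last g = last h \<longrightarrow> total_reward M g = total_reward M h)"


subsection \<open>Strategies and the induced probability measure\<close>

text \<open>The values of a strategy outside the partial runs ending in a controlled state are irrelevant.\<close>

definition strategies :: "'s mdp \<Rightarrow> ('s list \<Rightarrow> 's pmf) set" where
  "strategies M =
     {\<sigma>. \<forall>h\<in>partial_runs M. last h \<in> controlled M \<longrightarrow> set_pmf (\<sigma> h) \<subseteq> successors M (last h)}"

definition next_dist :: "'s mdp \<Rightarrow> ('s list \<Rightarrow> 's pmf) \<Rightarrow> 's list \<Rightarrow> 's pmf" where
  "next_dist M \<sigma> h = (if last h \<in> controlled M then \<sigma> h else succ_dist M (last h))"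

definition run_kernel ::
  "'s mdp \<Rightarrow> 's \<Rightarrow> ('s list \<Rightarrow> 's pmf) \<Rightarrow> nat \<Rightarrow> (nat \<Rightarrow> 's) \<Rightarrow> 's measure" where
  "run_kernel M s0 \<sigma> n x =
     measure_pmf (if n = 0 then return_pmf s0 else next_dist M \<sigma> (map x [0..<n]))"

text \<open>The Ionescu-Tulcea extension of these kernels to the product sigma-algebra on
  state sequences. That it is the measure with the usual cylinder probabilities is shown in
  \<open>run_measure_cylinder\<close> below.\<close>

definition run_measure ::
  "'s mdp \<Rightarrow> 's \<Rightarrow> ('s list \<Rightarrow> 's pmf) \<Rightarrow> (nat \<Rightarrow> 's) measure" where
  "run_measure M s0 \<sigma> =
     projective_family.lim UNIV
       (Ionescu_Tulcea.CI (run_kernel M s0 \<sigma>) (\<lambda>_. count_space UNIV)) (\<lambda>_. count_space UNIV)"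

definition run_prob ::
  "'s mdp \<Rightarrow> 's \<Rightarrow> ('s list \<Rightarrow> 's pmf) \<Rightarrow> (nat \<Rightarrow> 's) set \<Rightarrow> real" where
  "run_prob M s0 \<sigma> A = measure (run_measure M s0 \<sigma>) A"

definition val :: "'s mdp \<Rightarrow> 's \<Rightarrow> (nat \<Rightarrow> 's) set \<Rightarrow> real" where
  "val M s0 A = (SUP \<sigma>\<in>strategies M. run_prob M s0 \<sigma> A)"

definition eps_optimal ::
  "'s mdp \<Rightarrow> 's \<Rightarrow> (nat \<Rightarrow> 's) set \<Rightarrow> real \<Rightarrow> ('s list \<Rightarrow> 's pmf) \<Rightarrow> bool" where
  "eps_optimal M s0 A \<epsilon> \<sigma> \<longleftrightarrow> \<sigma> \<in> strategies M \<and> run_prob M s0 \<sigma> A \<ge> val M s0 A - \<epsilon>"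

definition MP_liminf_ge_0 :: "'s mdp \<Rightarrow> 's \<Rightarrow> (nat \<Rightarrow> 's) set" where
  "MP_liminf_ge_0 M s0 =
     {\<rho>\<in>runs M s0.
        liminf (\<lambda>n. ereal ((\<Sum>j<n. reward M (\<rho> j) (\<rho> (Suc j))) / real n)) \<ge> 0}"


subsection \<open>Strategies implemented with memory\<close>

text \<open>An update function \<open>\<tau>\<close> maps a memory mode and a state to a joint distribution over
  the next mode and the next state. At controlled states it determines the choice; at random
  states the next state must be distributed as prescribed by the MDP.\<close>

definition memory_update ::
  "'s mdp \<Rightarrow> 'm set \<Rightarrow> ('m \<Rightarrow> 's \<Rightarrow> ('m \<times> 's) pmf) \<Rightarrow> bool" where
  "memory_update M Mem \<tau> \<longleftrightarrow>
     (\<forall>m\<in>Mem. \<forall>s\<in>states M.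
        set_pmf (\<tau> m s) \<subseteq> Mem \<times> successors M s \<and>
        (s \<in> random_states M \<longrightarrow> map_pmf snd (\<tau> m s) = succ_dist M s))"

text \<open>The law of the state history together with the current mode after \<open>n\<close> steps of
  the Markov chain on modes and states given by \<open>\<tau>\<close>.\<close>

primrec memory_chain ::
  "('m \<Rightarrow> 's \<Rightarrow> ('m \<times> 's) pmf) \<Rightarrow> 'm \<Rightarrow> 's \<Rightarrow> nat \<Rightarrow> ('s list \<times> 'm) pmf" where
  "memory_chain \<tau> m0 s 0 = return_pmf ([s], m0)"
| "memory_chain \<tau> m0 s (Suc n) =
     bind_pmf (memory_chain \<tau> m0 s n)
       (\<lambda>(h, m). map_pmf (\<lambda>(m', s'). (h @ [s'], m')) (\<tau> m (last h)))"

definition history_prob :: "('m \<Rightarrow> 's \<Rightarrow> ('m \<times> 's) pmf) \<Rightarrow> 'm \<Rightarrow> 's list \<Rightarrow> real" where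
  "history_prob \<tau> m0 h =
     measure_pmf.prob (memory_chain \<tau> m0 (hd h) (length h - 1)) ({h} \<times> UNIV)"

text \<open>The modes are not observed, so the induced strategy chooses \<open>s'\<close> after \<open>h\<close> with the
  conditional probability that the chain moves to \<open>s'\<close> given that its state history is \<open>h\<close>.
  Histories of probability 0 leave the strategy unconstrained; they do not affect the
  induced measure.\<close>

definition implements ::
  "'s mdp \<Rightarrow> ('m \<Rightarrow> 's \<Rightarrow> ('m \<times> 's) pmf) \<Rightarrow> 'm \<Rightarrow> ('s list \<Rightarrow> 's pmf) \<Rightarrow> bool" where
  "implements M \<tau> m0 \<sigma> \<longleftrightarrow>
     (\<forall>h\<in>partial_runs M. last h \<in> controlled M \<and> history_prob \<tau> m0 h > 0 \<longrightarrow>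
        (\<forall>s'. pmf (\<sigma> h) s' = history_prob \<tau> m0 (h @ [s']) / history_prob \<tau> m0 h))"

text \<open>A finite set of modes may be taken to consist of natural numbers.\<close>

definition FR_strategies :: "'s mdp \<Rightarrow> ('s list \<Rightarrow> 's pmf) set" where
  "FR_strategies M =
     {\<sigma>\<in>strategies M. \<exists>(F :: nat set) m0 \<tau>.
        finite F \<and> m0 \<in> F \<and> memory_update M F \<tau> \<and> implements M \<tau> m0 \<sigma>}"

text \<open>With a reward counter, modes are pairs of a mode from a finite set and the counter value.
  The counter starts at 0 and is increased by the reward of the transition taken.\<close>

definition reward_counter_FR_strategies :: "'s mdp \<Rightarrow> ('s list \<Rightarrow> 's pmf) set" where
  "reward_counter_FR_strategies M =
     {\<sigma>\<in>strategies M. \<exists>(F :: nat set) m0 \<tau>.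
        finite F \<and> m0 \<in> F \<and>
        memory_update M (F \<times> (UNIV :: real set)) \<tau> \<and>
        (\<forall>m\<in>F. \<forall>c. \<forall>s\<in>states M. \<forall>((m', c'), s')\<in>set_pmf (\<tau> (m, c) s). c' = c + reward M s s') \<and>
        implements M \<tau> (m0, 0) \<sigma>}"


subsection \<open>Sanity of the measure and the objective\<close>

lemma Ionescu_Tulcea_run_kernel:
  fixes M :: "'s :: countable mdp"
  shows "Ionescu_Tulcea (run_kernel M s0 \<sigma>) (\<lambda>_. count_space UNIV)"
proof (rule Ionescu_Tulcea.intro)
  show "run_kernel M s0 \<sigma> i \<in>
      measurable (PiM {0..<i} (\<lambda>_. count_space UNIV)) (subprob_algebra (count_space UNIV))" for i
  proof -
    have eq: "PiM {0..<i} (\<lambda>_. count_space (UNIV :: 's set)) =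
        count_space (PiE {0..<i} (\<lambda>_. UNIV))"
      by (rule count_space_PiM_finite) auto
    show ?thesis
      unfolding eq by (auto simp: run_kernel_def measure_pmf_in_subprob_algebra)
  qed
  show "prob_space (run_kernel M s0 \<sigma> i x)" for i x
    by (simp add: run_kernel_def prob_space_measure_pmf)
qed

lemma sets_run_measure:
  fixes M :: "'s :: countable mdp"
  shows "sets (run_measure M s0 \<sigma>) = sets (PiM UNIV (\<lambda>_. count_space UNIV))"
proof -
  interpret Ionescu_Tulcea "run_kernel M s0 \<sigma>" "\<lambda>_. count_space UNIV"
    by (rule Ionescu_Tulcea_run_kernel)
  show ?thesis
    unfolding run_measure_def by (rule PF.sets_lim)
qed

lemma prob_space_run_measure:
  fixes M :: "'s :: countable mdp"
  shows "prob_space (run_measure M s0 \<sigma>)"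
proof -
  interpret Ionescu_Tulcea "run_kernel M s0 \<sigma>" "\<lambda>_. count_space UNIV"
    by (rule Ionescu_Tulcea_run_kernel)
  interpret E: prob_space "CI {}" by (rule PF.prob_space_P) simp_all
  have "emeasure PF.lim (PF.emb UNIV {} (space (PiM {} (\<lambda>_. count_space UNIV)))) = 1"
    using E.emeasure_space_1 by (subst lim) (auto simp: CI_def)
  moreover have "PF.emb UNIV {} (space (PiM {} (\<lambda>_. count_space UNIV))) = space PF.lim"
    by (auto simp: prod_emb_def space_PiM)
  ultimately show ?thesis
    unfolding run_measure_def by (intro prob_spaceI) simp
qed

lemma run_measure_cylinder:
  fixes M :: "'s :: countable mdp"
  assumes "h \<noteq> []"
  shows "run_prob M s0 \<sigma> {\<rho>. \<forall>i<length h. \<rho> i = h ! i} =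
    (if hd h = s0 then \<Prod>i<length h - 1. pmf (next_dist M \<sigma> (take (Suc i) h)) (h ! Suc i) else 0)"
proof -
  interpret Ionescu_Tulcea "run_kernel M s0 \<sigma>" "\<lambda>_. count_space UNIV"
    by (rule Ionescu_Tulcea_run_kernel)
  define x where "x n = restrict ((!) h) {0..<n}" for n :: nat
  define q where "q n = (if n = 0 then pmf (return_pmf s0) (h ! 0)
      else pmf (next_dist M \<sigma> (take n h)) (h ! n))" for n
  have PiM_eq: "PiM {0..<n} (\<lambda>_. count_space (UNIV :: 's set)) =
      count_space (PiE {0..<n} (\<lambda>_. UNIV))" for n :: nat
    by (rule count_space_PiM_finite) auto
  have x_in: "x n \<in> PiE {0..<n} (\<lambda>_. UNIV)" for n by (auto simp: x_def)
  have x_sets: "{x n} \<in> sets (PiM {0..<n} (\<lambda>_. count_space UNIV))" for n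
    using x_in unfolding PiM_eq by simp
  have und: "(\<lambda>_. undefined) \<in> space (PiM {0..<0} (\<lambda>_. count_space (UNIV :: 's set)))"
    by (auto simp: space_PiM)
  have C: "emeasure (C 0 n (\<lambda>_. undefined)) {x n} = ennreal (\<Prod>i<n. q i)"
    if "n \<le> length h" for n
    using that
  proof (induction n)
    case 0
    have "x 0 = (\<lambda>_. undefined)" by (simp add: x_def restrict_def)
    then show ?case using x_sets[of 0] by simp
  next
    case (Suc n)
    let ?C = "C 0 n (\<lambda>_. undefined)"
    have sp: "space ?C = PiE {0..<n} (\<lambda>_. UNIV)"
      by (subst space_C[OF und]) (simp add: space_PiM)
    have ne: "space ?C \<noteq> {}" using sp x_in by auto
    have "emeasure (C 0 (Suc n) (\<lambda>_. undefined)) {x (Suc n)} =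
        (\<integral>\<^sup>+ \<omega>. emeasure (eP n \<omega>) {x (Suc n)} \<partial>?C)"
      using measurable_eP[of n] sets_C[OF und, of n] x_sets[of "Suc n"] ne
      by (simp add: emeasure_bind[where N = "PiM {0..<Suc n} (\<lambda>_. count_space UNIV)"]
          cong: measurable_cong_sets)
    also have "\<dots> = (\<integral>\<^sup>+ \<omega>. ennreal (q n) * indicator {x n} \<omega> \<partial>?C)"
    proof (rule nn_integral_cong)
      fix \<omega> assume "\<omega> \<in> space ?C"
      then have \<omega>: "\<omega> \<in> PiE {0..<n} (\<lambda>_. UNIV)" by (simp add: sp)
      have upd: "(fun_upd \<omega> n y = x (Suc n)) \<longleftrightarrow> (\<omega> = x n \<and> y = h ! n)" for y
      proof
        assume *: "fun_upd \<omega> n y = x (Suc n)"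
        have "\<omega> i = x n i" for i
          using fun_cong[OF *, of i] \<omega> by (cases "i < n") (auto simp: x_def PiE_def extensional_def)
        then show "\<omega> = x n \<and> y = h ! n"
          using fun_cong[OF *, of n] by (auto simp: x_def)
      next
        assume "\<omega> = x n \<and> y = h ! n"
        then show "fun_upd \<omega> n y = x (Suc n)" by (auto simp: x_def fun_eq_iff)
      qed
      have map_x: "map (x n) [0..<n] = take n h"
        using Suc.prems by (intro nth_equalityI) (auto simp: x_def)
      have "emeasure (eP n \<omega>) {x (Suc n)} =
          run_kernel M s0 \<sigma> n \<omega> (fun_upd \<omega> n -` {x (Suc n)} \<inter> space (count_space UNIV))"
        by (rule emeasure_eP) (use \<omega> x_sets in \<open>auto simp: space_PiM\<close>)
      also have "fun_upd \<omega> n -` {x (Suc n)} \<inter> space (count_space UNIV) =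
          (if \<omega> = x n then {h ! n} else {})"
        using upd by auto
      also have "emeasure (run_kernel M s0 \<sigma> n \<omega>) \<dots> = ennreal (q n) * indicator {x n} \<omega>"
        using map_x by (auto simp: run_kernel_def q_def emeasure_pmf_single)
      finally show "emeasure (eP n \<omega>) {x (Suc n)} = ennreal (q n) * indicator {x n} \<omega>" .
    qed
    also have "\<dots> = ennreal (q n) * emeasure ?C {x n}"
      using x_sets[of n] sets_C[OF und, of n] by (subst nn_integral_cmult_indicator) auto
    also have "\<dots> = ennreal (\<Prod>i<Suc n. q i)"
      using Suc by (simp add: ennreal_mult' mult.commute prod_nonneg q_def)
    finally show ?case .
  qed
  let ?n = "length h"
  have cyl: "{\<rho>. \<forall>i<?n. \<rho> i = h ! i} = PF.emb UNIV {0..<?n} {x ?n}"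
    by (auto simp: prod_emb_def x_def fun_eq_iff restrict_def space_PiM split: if_splits)
  have "emeasure PF.lim (PF.emb UNIV {0..<?n} {x ?n}) = emeasure (CI {0..<?n}) {x ?n}"
    using x_sets by (intro lim) auto
  also have "\<dots> = emeasure (C 0 ?n (\<lambda>_. undefined)) (PF.emb {0..<?n} {0..<?n} {x ?n})"
    using x_sets by (intro emeasure_CI) auto
  also have "PF.emb {0..<?n} {0..<?n} {x ?n} = {x ?n}"
    using x_in[of ?n] by (intro prod_emb_id) auto
  also have "emeasure (C 0 ?n (\<lambda>_. undefined)) {x ?n} = ennreal (\<Prod>i<?n. q i)"
    by (rule C) simp
  finally have "run_prob M s0 \<sigma> {\<rho>. \<forall>i<?n. \<rho> i = h ! i} = (\<Prod>i<?n. q i)"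
    unfolding run_prob_def run_measure_def cyl measure_def
    by (simp add: prod_nonneg q_def)
  also have "\<dots> = q 0 * (\<Prod>i<?n - 1. q (Suc i))"
    using assms by (cases h) (simp_all add: prod.lessThan_Suc_shift del: prod.lessThan_Suc)
  also have "q 0 = (if hd h = s0 then 1 else 0)"
    using assms by (simp add: q_def hd_conv_nth)
  finally show ?thesis by (simp add: q_def)
qed

lemma MP_liminf_ge_0_measurable:
  fixes M :: "'s :: countable mdp"
  shows "MP_liminf_ge_0 M s0 \<in> sets (run_measure M s0 \<sigma>)"
proof -
  let ?P = "PiM UNIV (\<lambda>_ :: nat. count_space (UNIV :: 's set))"
  have [measurable]: "(\<lambda>\<rho>. (\<rho> i, \<rho> (Suc i))) \<in> measurable ?P (count_space UNIV)" for i
    by measurable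
  have [measurable]: "(\<lambda>\<rho>. reward M (\<rho> i) (\<rho> (Suc i))) \<in> borel_measurable ?P" for i
    using measurable_compose[OF _ measurable_count_space[of "\<lambda>(s, t). reward M s t"],
        of "\<lambda>\<rho>. (\<rho> i, \<rho> (Suc i))" ?P] by simp
  have [measurable]: "Measurable.pred ?P (\<lambda>\<rho>. (\<rho> i, \<rho> (Suc i)) \<in> edges M)" for i
    using measurable_compose[OF _ measurable_count_space[of "\<lambda>e. e \<in> edges M"],
        of "\<lambda>\<rho>. (\<rho> i, \<rho> (Suc i))" ?P] by simp
  have "Measurable.pred ?P (\<lambda>\<rho>. (\<rho> 0 = s0 \<and> (\<forall>i. (\<rho> i, \<rho> (Suc i)) \<in> edges M)) \<and>
      liminf (\<lambda>n. ereal ((\<Sum>j<n. reward M (\<rho> j) (\<rho> (Suc j))) / real n)) \<ge> 0)"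
    by measurable
  then have "{\<rho>\<in>space ?P. (\<rho> 0 = s0 \<and> (\<forall>i. (\<rho> i, \<rho> (Suc i)) \<in> edges M)) \<and>
      liminf (\<lambda>n. ereal ((\<Sum>j<n. reward M (\<rho> j) (\<rho> (Suc j))) / real n)) \<ge> 0} \<in> sets ?P"
    by measurable
  then show ?thesis
    by (simp add: sets_run_measure MP_liminf_ge_0_def runs_def space_PiM)
qed

end

theory Submission
  imports Defs
begin

text \<open>
  Each stage starts and ends with total reward \<open>0\<close>. First the random player picks a level
  \<open>i \<le> k\<close>, reaching the controller's first state after a waiting time that grows steeply with
  \<open>i\<close>. The controller then walks through dips \<open>0, 1, 2, \<dots>\<close> (descents of the total reward that
  are undone afterwards) and may exit before any of them; exiting before dip \<open>j\<close> risks, with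
  probability \<open>y\<^sup>j\<^sup>+\<^sup>1\<close>, one dip that is too deep whatever the level. Dip \<open>j\<close> is
  negligible compared with the time elapsed at levels above \<open>j\<close>, but pushes the mean payoff down
  to \<open>-1/2\<close> or less at levels up to \<open>j\<close>. Level \<open>i\<close> has probability about \<open>y\<^sup>k\<^sup>-\<^sup>i\<close>,
  so a controller that remembers \<open>i\<close> and exits before dip \<open>i\<close> fails with probability at most
  \<open>k y\<^sup>k\<^sup>+\<^sup>1\<close>, whereas one with at most \<open>k\<close> memory modes confuses two levels and fails
  with probability of order \<open>y\<^sup>k\<close>. With \<open>y = 8\<^sup>-\<^sup>(\<^sup>k\<^sup>+\<^sup>1\<^sup>)\<close>, the same \<open>k\<close> is used in so many
  consecutive stages that the larger failure probabilities sum to infinity and the smaller ones do not.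
  By Borel--Cantelli the first controller fails only finitely often almost surely, and the second
  almost surely fails infinitely often. Since the total reward is a function of the state, a reward
  counter is of no help.
\<close>

subsection \<open>Cylinders and the run measure\<close>

definition cylinder :: "'s list \<Rightarrow> (nat \<Rightarrow> 's) set" where
  "cylinder h = {\<rho>. \<forall>i<length h. \<rho> i = h ! i}"

abbreviation seq_algebra :: "(nat \<Rightarrow> 's) measure" where
  "seq_algebra \<equiv> PiM UNIV (\<lambda>_. count_space UNIV)"

lemma in_cylinder_iff: "\<rho> \<in> cylinder h \<longleftrightarrow> map \<rho> [0..<length h] = h"
  by (simp add: cylinder_def list_eq_iff_nth_eq[of "map \<rho> [0..<length h]"])

lemma cylinder_append_subset: "cylinder (h @ p) \<subseteq> cylinder h"
  by (auto simp: cylinder_def nth_append split: if_splits)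

lemma space_run_measure [simp]:
  fixes M :: "'s :: countable mdp"
  shows "space (run_measure M s0 \<sigma>) = UNIV"
  using sets_eq_imp_space_eq[OF sets_run_measure[of M s0 \<sigma>]] by (simp add: space_PiM)

lemma pred_at [measurable]:
  "Measurable.pred seq_algebra (\<lambda>\<rho>. P (\<rho> (t::nat)))"
  by (rule measurable_compose[of "\<lambda>\<rho>. \<rho> t" _ "count_space UNIV"]) simp_all

lemma in_sets_run_measure:
  fixes M :: "'s :: countable mdp"
  assumes "Measurable.pred seq_algebra (\<lambda>\<rho>. \<rho> \<in> A)"
  shows "A \<in> sets (run_measure M s0 \<sigma>)"
  using assms by (simp add: sets_run_measure pred_def space_PiM)

lemma cylinder_sets [measurable, simp]:
  fixes M :: "'s :: countable mdp"
  shows "cylinder h \<in> sets (run_measure M s0 \<sigma>)"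
  by (rule in_sets_run_measure) (simp add: cylinder_def)

lemma prob_cylinder_snoc:
  fixes M :: "'s :: countable mdp"
  assumes "h \<noteq> []"
  shows "run_prob M s0 \<sigma> (cylinder (h @ [s])) =
    run_prob M s0 \<sigma> (cylinder h) * pmf (next_dist M \<sigma> h) s"
proof -
  have len: "length h = Suc (length h - 1)" using assms by (cases h) auto
  have "(\<Prod>i<length h. pmf (next_dist M \<sigma> (take (Suc i) (h @ [s]))) ((h @ [s]) ! Suc i)) =
    (\<Prod>i<length h - 1. pmf (next_dist M \<sigma> (take (Suc i) h)) (h ! Suc i)) * pmf (next_dist M \<sigma> h) s"
    by (subst len, subst prod.lessThan_Suc) (use assms in \<open>auto simp: nth_append intro!: prod.cong\<close>)
  then show ?thesis
    using run_measure_cylinder[of "h @ [s]" M s0 \<sigma>] run_measure_cylinder[of h M s0 \<sigma>] assms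
    by (simp add: cylinder_def)
qed

lemma prob_cylinder_singleton:
  fixes M :: "'s :: countable mdp"
  shows "run_prob M s0 \<sigma> (cylinder [s]) = (if s = s0 then 1 else 0)"
  using run_measure_cylinder[of "[s]" M s0 \<sigma>] by (simp add: cylinder_def)

text \<open>There are only countably many histories, so the null cylinders have a null union.
  \<open>AE_consistent\<close> then reads off that almost every run makes only moves of positive
  probability.\<close>

lemma AE_prefix_pos:
  fixes M :: "'s :: countable mdp"
  shows "AE \<rho> in run_measure M s0 \<sigma>. \<forall>n. run_prob M s0 \<sigma> (cylinder (map \<rho> [0..<n])) \<noteq> 0"
proof -
  interpret prob_space "run_measure M s0 \<sigma>" by (rule prob_space_run_measure)
  have "AE \<rho> in run_measure M s0 \<sigma>. run_prob M s0 \<sigma> (cylinder h) = 0 \<longrightarrow> \<rho> \<notin> cylinder h" for h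
  proof (cases "run_prob M s0 \<sigma> (cylinder h) = 0")
    case True
    then have "cylinder h \<in> null_sets (run_measure M s0 \<sigma>)"
      by (intro null_setsI) (simp_all add: run_prob_def emeasure_eq_measure)
    then show ?thesis by (rule AE_mp[OF AE_not_in]) simp
  qed simp
  then have "AE \<rho> in run_measure M s0 \<sigma>. \<forall>h. run_prob M s0 \<sigma> (cylinder h) = 0 \<longrightarrow> \<rho> \<notin> cylinder h"
    by (simp add: AE_all_countable)
  then show ?thesis
    by (rule AE_mp) (intro AE_I2, metis in_cylinder_iff length_map length_upt minus_nat.diff_0)
qed

lemma AE_consistent:
  fixes M :: "'s :: countable mdp"
  shows "AE \<rho> in run_measure M s0 \<sigma>.
    \<rho> 0 = s0 \<and> (\<forall>n. \<rho> (Suc n) \<in> set_pmf (next_dist M \<sigma> (map \<rho> [0..<Suc n])))"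
  using AE_prefix_pos[of M s0 \<sigma>]
proof (rule AE_mp, intro AE_I2 impI conjI allI)
  fix \<rho> assume pos: "\<forall>n. run_prob M s0 \<sigma> (cylinder (map \<rho> [0..<n])) \<noteq> 0"
  show "\<rho> 0 = s0"
    using pos[rule_format, of 1] by (auto simp: prob_cylinder_singleton split: if_splits)
  show "\<rho> (Suc n) \<in> set_pmf (next_dist M \<sigma> (map \<rho> [0..<Suc n]))" for n
    using pos[rule_format, of "Suc (Suc n)"] prob_cylinder_snoc[of "map \<rho> [0..<Suc n]" M s0 \<sigma> "\<rho> (Suc n)"]
    by (auto simp: set_pmf_iff)
qed

lemma prefix_partial_run:
  assumes "\<rho> \<in> runs M s0" "mdp M"
  shows "map \<rho> [0..<Suc n] \<in> partial_runs M"
proof -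
  have e: "(\<rho> i, \<rho> (Suc i)) \<in> edges M" for i using assms by (auto simp: runs_def)
  then have "\<rho> i \<in> states M" for i using assms(2) by (auto simp: mdp_def)
  then show ?thesis using e by (auto simp: partial_runs_def simp del: upt_Suc)
qed

lemma AE_runs:
  fixes M :: "'s :: countable mdp"
  assumes "mdp M" "s0 \<in> states M" "\<sigma> \<in> strategies M"
  shows "AE \<rho> in run_measure M s0 \<sigma>. \<rho> \<in> runs M s0"
  using AE_consistent[of s0 M \<sigma>]
proof (rule AE_mp, intro AE_I2 impI)
  fix \<rho> assume *: "\<rho> 0 = s0 \<and> (\<forall>n. \<rho> (Suc n) \<in> set_pmf (next_dist M \<sigma> (map \<rho> [0..<Suc n])))"
  have pr: "map \<rho> [0..<Suc n] \<in> partial_runs M" for n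
  proof (induction n)
    case 0
    then show ?case using * assms(2) by (auto simp: partial_runs_def)
  next
    case (Suc n)
    have st: "\<rho> n \<in> states M" using Suc by (auto simp: partial_runs_def)
    have "\<rho> (Suc n) \<in> successors M (\<rho> n)"
    proof (cases "\<rho> n \<in> controlled M")
      case True
      then have "\<rho> (Suc n) \<in> set_pmf (\<sigma> (map \<rho> [0..<Suc n]))"
        using *[THEN conjunct2, rule_format, of n] by (simp add: next_dist_def)
      moreover have "last (map \<rho> [0..<Suc n]) = \<rho> n" by simp
      ultimately show ?thesis using Suc True assms(3) unfolding strategies_def by fastforce
    next
      case False
      then show ?thesis using *[THEN conjunct2, rule_format, of n] assms(1) st
        by (auto simp: next_dist_def mdp_def states_def)
    qed
    then have e: "(\<rho> n, \<rho> (Suc n)) \<in> edges M" by (simp add: successors_def)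
    then have "\<rho> (Suc n) \<in> states M" using assms(1) by (auto simp: mdp_def)
    have "(map \<rho> [0..<Suc (Suc n)] ! i, map \<rho> [0..<Suc (Suc n)] ! Suc i) \<in> edges M"
      if "Suc i < Suc (Suc n)" for i
    proof (cases "i = n")
      case True then show ?thesis using e by (simp del: upt_Suc)
    next
      case False
      then have "Suc i < Suc n" using that by simp
      moreover have "\<forall>i. Suc i < Suc n \<longrightarrow> (map \<rho> [0..<Suc n] ! i, map \<rho> [0..<Suc n] ! Suc i) \<in> edges M"
        using Suc by (simp add: partial_runs_def del: upt_Suc)
      ultimately show ?thesis by (simp del: upt_Suc)
    qed
    then show ?case using Suc \<open>\<rho> (Suc n) \<in> states M\<close>
      by (auto simp: partial_runs_def simp del: upt_Suc) (auto simp: less_Suc_eq)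
  qed
  have "(\<rho> i, \<rho> (Suc i)) \<in> edges M" for i
    using pr[of "Suc i"] by (auto simp: partial_runs_def simp del: upt_Suc)
  then show "\<rho> \<in> runs M s0" using * by (simp add: runs_def)
qed

text \<open>Averages a conditional bound over disjoint histories, as in the strong Markov property.
  There may be infinitely many of them, hence the integral over \<open>count_space H\<close>. The
  upper bound in \<open>cylinder_union_le\<close> is obtained in the same way.\<close>

lemma cylinder_union_ge:
  fixes M :: "'s :: countable mdp"
  assumes disj: "disjoint_family_on cylinder H"
    and B: "B \<in> sets (run_measure M s0 \<sigma>)" and "0 \<le> c"
    and le: "\<And>h. h \<in> H \<Longrightarrow>
      c * run_prob M s0 \<sigma> (cylinder h) \<le> run_prob M s0 \<sigma> (cylinder h \<inter> B)"
  shows "c * run_prob M s0 \<sigma> (\<Union>h\<in>H. cylinder h) \<le> run_prob M s0 \<sigma> ((\<Union>h\<in>H. cylinder h) \<inter> B)"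
proof -
  let ?\<mu> = "run_measure M s0 \<sigma>"
  interpret prob_space ?\<mu> by (rule prob_space_run_measure)
  have "ennreal c * emeasure ?\<mu> (\<Union>h\<in>H. cylinder h) =
      (\<integral>\<^sup>+h. ennreal c * emeasure ?\<mu> (cylinder h) \<partial>count_space H)"
    by (subst emeasure_UN_countable[OF _ _ disj]) (auto simp: nn_integral_cmult)
  also have "\<dots> \<le> (\<integral>\<^sup>+h. emeasure ?\<mu> (cylinder h \<inter> B) \<partial>count_space H)"
    using le \<open>0 \<le> c\<close>
    by (intro nn_integral_mono) (auto simp: emeasure_eq_measure run_prob_def ennreal_mult[symmetric])
  also have "\<dots> = emeasure ?\<mu> (\<Union>h\<in>H. cylinder h \<inter> B)"
    using disj B by (subst emeasure_UN_countable) (auto simp: disjoint_family_on_def)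
  also have "(\<Union>h\<in>H. cylinder h \<inter> B) = (\<Union>h\<in>H. cylinder h) \<inter> B" by auto
  finally show ?thesis
    using \<open>0 \<le> c\<close> by (simp add: emeasure_eq_measure run_prob_def ennreal_mult[symmetric])
qed

lemma cylinder_union_le:
  fixes M :: "'s :: countable mdp"
  assumes disj: "disjoint_family_on cylinder H"
    and B: "B \<in> sets (run_measure M s0 \<sigma>)" and "0 \<le> c"
    and le: "\<And>h. h \<in> H \<Longrightarrow>
      run_prob M s0 \<sigma> (cylinder h \<inter> B) \<le> c * run_prob M s0 \<sigma> (cylinder h)"
  shows "run_prob M s0 \<sigma> ((\<Union>h\<in>H. cylinder h) \<inter> B) \<le> c * run_prob M s0 \<sigma> (\<Union>h\<in>H. cylinder h)"
proof -
  let ?\<mu> = "run_measure M s0 \<sigma>"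
  interpret prob_space ?\<mu> by (rule prob_space_run_measure)
  have "(\<Union>h\<in>H. cylinder h) \<inter> B = (\<Union>h\<in>H. cylinder h \<inter> B)" by auto
  then have "emeasure ?\<mu> ((\<Union>h\<in>H. cylinder h) \<inter> B) = emeasure ?\<mu> (\<Union>h\<in>H. cylinder h \<inter> B)"
    by simp
  also have "\<dots> = (\<integral>\<^sup>+h. emeasure ?\<mu> (cylinder h \<inter> B) \<partial>count_space H)"
    using disj B by (subst emeasure_UN_countable) (auto simp: disjoint_family_on_def)
  also have "\<dots> \<le> (\<integral>\<^sup>+h. ennreal c * emeasure ?\<mu> (cylinder h) \<partial>count_space H)"
    using le \<open>0 \<le> c\<close>
    by (intro nn_integral_mono) (auto simp: emeasure_eq_measure run_prob_def ennreal_mult[symmetric])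
  also have "\<dots> = ennreal c * emeasure ?\<mu> (\<Union>h\<in>H. cylinder h)"
    by (subst emeasure_UN_countable[OF _ _ disj]) (auto simp: nn_integral_cmult)
  finally show ?thesis
    using \<open>0 \<le> c\<close> by (simp add: emeasure_eq_measure run_prob_def ennreal_mult[symmetric])
qed

text \<open>If a run had prefixes of two different lengths in \<open>H\<close>, the state
  \<open>s\<close> ending the shorter one would occur before the end of the longer one. Prefixes of
  equal length coincide.\<close>

lemma disjoint_cylinders_last_visit:
  assumes "\<And>h. h \<in> H \<Longrightarrow> h \<noteq> [] \<and> last h = s \<and> s \<notin> set (butlast h)"
  shows "disjoint_family_on cylinder H"
proof -
  have "length h = length h'" if "h \<in> H" "h' \<in> H" "\<rho> \<in> cylinder h" "\<rho> \<in> cylinder h'" for h h' \<rho>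
  proof -
    have *: "\<not> length g < length g'"
      if "g \<in> H" "g' \<in> H" "\<rho> \<in> cylinder g" "\<rho> \<in> cylinder g'" for g g'
    proof
      assume l: "length g < length g'"
      have "g \<noteq> []" "last g = s" using assms that by auto
      then have "\<rho> (length g - 1) = s" using that by (auto simp: cylinder_def last_conv_nth)
      moreover have "\<rho> (length g - 1) = butlast g' ! (length g - 1)"
        using l that \<open>g \<noteq> []\<close> by (cases g) (auto simp: cylinder_def nth_butlast)
      moreover have "length g - 1 < length (butlast g')" using l \<open>g \<noteq> []\<close> by (cases g) auto
      ultimately have "s \<in> set (butlast g')" by (metis nth_mem)
      then show False using assms that by auto
    qed
    show ?thesis using *[of h h'] *[of h' h] that by auto
  qed
  then show ?thesis
    unfolding disjoint_family_on_def by (metis disjoint_iff in_cylinder_iff)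
qed

text \<open>Histories are cut at the first visit to \<open>s\<close>, which makes their cylinders disjoint.\<close>

lemma prob_edge_le:
  fixes M :: "'s :: countable mdp"
  assumes s: "s \<notin> controlled M"
    and once: "AE \<rho> in run_measure M s0 \<sigma>. \<forall>i j. \<rho> i = s \<and> \<rho> j = s \<longrightarrow> i = j"
  shows "run_prob M s0 \<sigma> {\<rho>. \<exists>t. \<rho> t = s \<and> \<rho> (Suc t) = s'} \<le>
    pmf (succ_dist M s) s' * run_prob M s0 \<sigma> {\<rho>. \<exists>t. \<rho> t = s}"
proof -
  let ?\<mu> = "run_measure M s0 \<sigma>"
  interpret prob_space ?\<mu> by (rule prob_space_run_measure)
  define H where "H = {h. h \<noteq> [] \<and> last h = s \<and> s \<notin> set (butlast h)}"
  \<comment> \<open>Asking for a first visit ties \<open>t\<close> to the history: on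
    \<open>cylinder h\<close> it must be \<open>length h - 1\<close>.\<close>
  define B where "B = {\<rho>. \<exists>t. \<rho> t = s \<and> \<rho> (Suc t) = s' \<and> (\<forall>i<t. \<rho> i \<noteq> s)}"
  have B: "B \<in> sets ?\<mu>" unfolding B_def by (rule in_sets_run_measure) simp
  have H: "(\<Union>h\<in>H. cylinder h) = {\<rho>. \<exists>t. \<rho> t = s}"
  proof (intro set_eqI iffI)
    fix \<rho> assume "\<rho> \<in> (\<Union>h\<in>H. cylinder h)"
    then obtain h where h: "h \<in> H" "\<rho> \<in> cylinder h" by blast
    then have "\<rho> (length h - 1) = s" by (auto simp: H_def cylinder_def last_conv_nth)
    then show "\<rho> \<in> {\<rho>. \<exists>t. \<rho> t = s}" by blast
  next
    fix \<rho> :: "nat \<Rightarrow> 's" assume "\<rho> \<in> {\<rho>. \<exists>t. \<rho> t = s}"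
    then have "\<exists>t. \<rho> t = s" by simp
    then obtain t where t: "\<rho> t = s" "\<forall>i<t. \<rho> i \<noteq> s"
      unfolding exists_least_iff[of "\<lambda>t. \<rho> t = s"] by blast
    then have "map \<rho> [0..<Suc t] = map \<rho> [0..<t] @ [s]" "s \<notin> set (map \<rho> [0..<t])" by auto
    then have "map \<rho> [0..<Suc t] \<in> H"
      unfolding H_def mem_Collect_eq by (metis append_is_Nil_conv butlast_snoc last_snoc list.distinct(1))
    moreover have "\<rho> \<in> cylinder (map \<rho> [0..<Suc t])" by (simp add: in_cylinder_iff del: upt_Suc)
    ultimately show "\<rho> \<in> (\<Union>h\<in>H. cylinder h)" by blast
  qed
  have cyl: "cylinder h \<inter> B \<subseteq> cylinder (h @ [s'])" if h: "h \<in> H" for h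
  proof
    fix \<rho> assume \<rho>: "\<rho> \<in> cylinder h \<inter> B"
    then obtain t where t: "\<rho> t = s" "\<rho> (Suc t) = s'" "\<forall>i<t. \<rho> i \<noteq> s" by (auto simp: B_def)
    have a: "h \<noteq> []" "\<rho> (length h - 1) = s" using \<rho> h by (auto simp: H_def cylinder_def last_conv_nth)
    have "\<rho> i \<noteq> s" if "i < length h - 1" for i
    proof -
      have "butlast h ! i = \<rho> i" using \<rho> that by (auto simp: cylinder_def nth_butlast)
      then show ?thesis using h that unfolding H_def by (metis (mono_tags, lifting) length_butlast mem_Collect_eq nth_mem)
    qed
    then have "t = length h - 1" using t a by (metis linorder_neqE_nat)
    then have "Suc t = length h" using a by (cases h) auto
    then show "\<rho> \<in> cylinder (h @ [s'])" using \<rho> t by (auto simp: cylinder_def nth_append less_Suc_eq)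
  qed
  have "run_prob M s0 \<sigma> ((\<Union>h\<in>H. cylinder h) \<inter> B) \<le>
      pmf (succ_dist M s) s' * run_prob M s0 \<sigma> (\<Union>h\<in>H. cylinder h)"
  proof (rule cylinder_union_le[OF _ B])
    show "disjoint_family_on cylinder H"
      by (rule disjoint_cylinders_last_visit[where s = s]) (auto simp: H_def)
    fix h assume h: "h \<in> H"
    have "run_prob M s0 \<sigma> (cylinder h \<inter> B) \<le> run_prob M s0 \<sigma> (cylinder (h @ [s']))"
      unfolding run_prob_def using cyl[OF h] by (intro finite_measure_mono) auto
    also have "\<dots> = pmf (succ_dist M s) s' * run_prob M s0 \<sigma> (cylinder h)"
      using h s by (subst prob_cylinder_snoc) (auto simp: H_def next_dist_def)
    finally show "run_prob M s0 \<sigma> (cylinder h \<inter> B) \<le> pmf (succ_dist M s) s' * run_prob M s0 \<sigma> (cylinder h)" .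
  qed simp
  moreover have "run_prob M s0 \<sigma> {\<rho>. \<exists>t. \<rho> t = s \<and> \<rho> (Suc t) = s'} \<le>
      run_prob M s0 \<sigma> ((\<Union>h\<in>H. cylinder h) \<inter> B)"
    unfolding run_prob_def
  proof (rule finite_measure_mono_AE)
    show "AE \<rho> in ?\<mu>. \<rho> \<in> {\<rho>. \<exists>t. \<rho> t = s \<and> \<rho> (Suc t) = s'} \<longrightarrow> \<rho> \<in> (\<Union>h\<in>H. cylinder h) \<inter> B"
      using once
    proof (rule AE_mp, intro AE_I2 impI)
      fix \<rho> assume u: "\<forall>i j. \<rho> i = s \<and> \<rho> j = s \<longrightarrow> i = j" and "\<rho> \<in> {\<rho>. \<exists>t. \<rho> t = s \<and> \<rho> (Suc t) = s'}"
      then obtain t where t: "\<rho> t = s" "\<rho> (Suc t) = s'" by blast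
      moreover have "\<rho> i \<noteq> s" if "i < t" for i using u t(1) that by fastforce
      ultimately show "\<rho> \<in> (\<Union>h\<in>H. cylinder h) \<inter> B" unfolding H B_def by blast
    qed
    show "(\<Union>h\<in>H. cylinder h) \<inter> B \<in> sets ?\<mu>" using B by auto
  qed
  ultimately show ?thesis using H by simp
qed

subsection \<open>Finite-memory strategies along paths\<close>

text \<open>These are the forward probabilities of a hidden Markov model whose hidden states are the
  modes. They keep the mode that \<open>history_prob\<close> sums out.\<close>

definition path_weight :: "('m \<Rightarrow> 's \<Rightarrow> ('m \<times> 's) pmf) \<Rightarrow> 'm \<Rightarrow> 's list \<Rightarrow> 'm \<Rightarrow> real" where
  "path_weight \<tau> m h m' = pmf (memory_chain \<tau> m (hd h) (length h - 1)) (h, m')"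

lemma path_weight_nonneg [simp]: "0 \<le> path_weight \<tau> m h m'"
  by (simp add: path_weight_def)

lemma path_weight_singleton: "path_weight \<tau> m [s] m' = (if m' = m then 1 else 0)"
  by (auto simp: path_weight_def)

lemma partial_runs_snoc:
  assumes "mdp M" "h \<in> partial_runs M" "s \<in> successors M (last h)"
  shows "h @ [s] \<in> partial_runs M"
proof -
  have h: "h \<noteq> []" "set h \<subseteq> states M" "\<And>i. Suc i < length h \<Longrightarrow> (h ! i, h ! Suc i) \<in> edges M"
    using assms(2) by (auto simp: partial_runs_def)
  have e: "(last h, s) \<in> edges M" using assms(3) by (simp add: successors_def)
  then have "s \<in> states M" using assms(1) by (auto simp: mdp_def)
  moreover have "((h @ [s]) ! i, (h @ [s]) ! Suc i) \<in> edges M" if "Suc i < length (h @ [s])" for i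
  proof (cases "Suc i < length h")
    case True
    then show ?thesis using h by (simp add: nth_append)
  next
    case False
    then have "i = length h - 1" "Suc i = length h" using that h(1) by auto
    then show ?thesis using e h(1) by (simp add: nth_append last_conv_nth)
  qed
  ultimately show ?thesis using h by (auto simp: partial_runs_def)
qed

lemma partial_runs_prefix:
  assumes "h @ p \<in> partial_runs M" "h \<noteq> []"
  shows "h \<in> partial_runs M"
proof -
  have "(h ! i, h ! Suc i) \<in> edges M" if "Suc i < length h" for i
  proof -
    have "((h @ p) ! i, (h @ p) ! Suc i) \<in> edges M" using assms(1) that by (simp add: partial_runs_def)
    then show ?thesis using that by (simp add: nth_append)
  qed
  then show ?thesis using assms by (auto simp: partial_runs_def)
qed

lemma memory_chain_support:
  assumes "mdp M" "memory_update M F \<tau>" "m \<in> F" "s \<in> states M"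
    and "(h, m') \<in> set_pmf (memory_chain \<tau> m s n)"
  shows "length h = Suc n \<and> hd h = s \<and> m' \<in> F \<and> h \<in> partial_runs M"
  using assms(5)
proof (induction n arbitrary: h m')
  case 0
  then show ?case using assms by (auto simp: partial_runs_def)
next
  case (Suc n)
  then obtain g k m2 t where g: "(g, k) \<in> set_pmf (memory_chain \<tau> m s n)"
    "(m2, t) \<in> set_pmf (\<tau> k (last g))" "h = g @ [t]" "m' = m2"
    by auto
  have *: "length g = Suc n" "hd g = s" "k \<in> F" "g \<in> partial_runs M" using Suc.IH[OF g(1)] by auto
  then have "last g \<in> states M" by (auto simp: partial_runs_def)
  then have "m2 \<in> F" "t \<in> successors M (last g)"
    using assms(2) g(2) * by (auto simp: memory_update_def)
  moreover have "g \<noteq> []" using * by auto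
  ultimately show ?case using * g partial_runs_snoc[OF assms(1), of g t] by auto
qed

lemma sum_singleton_Times: "sum f ({a} \<times> B) = (\<Sum>b\<in>B. f (a, b))"
proof -
  have "{a} \<times> B = Pair a ` B" by auto
  then show ?thesis by (simp add: sum.reindex inj_on_def)
qed

lemma sum_Times_singleton: "sum f (A \<times> {b}) = (\<Sum>a\<in>A. f (a, b))"
proof -
  have "A \<times> {b} = (\<lambda>a. (a, b)) ` A" by auto
  then show ?thesis by (simp add: sum.reindex inj_on_def)
qed

locale finite_memory =
  fixes M :: "'s :: countable mdp" and F :: "'m set" and \<tau> :: "'m \<Rightarrow> 's \<Rightarrow> ('m \<times> 's) pmf"
  assumes mdp: "mdp M" and finite_F: "finite F" and update: "memory_update M F \<tau>"
begin

lemma path_weight_snoc: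
  assumes "h \<noteq> []" "m \<in> F" "hd h \<in> states M"
  shows "path_weight \<tau> m (h @ [s]) m'' =
    (\<Sum>m'\<in>F. path_weight \<tau> m h m' * pmf (\<tau> m' (last h)) (m'', s))"
proof -
  let ?N = "memory_chain \<tau> m (hd h) (length h - 1)"
  let ?f = "\<lambda>(g, m'). map_pmf (\<lambda>(m2, t). (g @ [t], m2)) (\<tau> m' (last g))"
  have inner: "pmf (?f (g, m')) (h @ [s], m'') =
      (if g = h then pmf (\<tau> m' (last h)) (m'', s) else 0)" for g m'
  proof (cases "g = h")
    case True
    have "pmf (map_pmf (\<lambda>(m2, t). (h @ [t], m2)) (\<tau> m' (last h))) ((\<lambda>(m2, t). (h @ [t], m2)) (m'', s)) =
        pmf (\<tau> m' (last h)) (m'', s)"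
      by (rule pmf_map_inj') (auto simp: inj_def)
    then show ?thesis using True by simp
  next
    case False
    then have "(h @ [s], m'') \<notin> set_pmf (?f (g, m'))" by auto
    then show ?thesis using False by (simp add: set_pmf_iff del: set_map_pmf)
  qed
  have len: "length (h @ [s]) - 1 = Suc (length h - 1)" using assms by (cases h) auto
  have "path_weight \<tau> m (h @ [s]) m'' = (\<integral>x. pmf (?f x) (h @ [s], m'') \<partial>measure_pmf ?N)"
    unfolding path_weight_def len hd_append2[OF assms(1)] memory_chain.simps pmf_bind ..
  also have "\<dots> = (\<Sum>x\<in>{h} \<times> F. pmf (?f x) (h @ [s], m'') * pmf ?N x)"
  proof (rule integral_measure_pmf_real)
    fix x assume x: "x \<in> set_pmf ?N" "pmf (?f x) (h @ [s], m'') \<noteq> 0"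
    obtain g m' where [simp]: "x = (g, m')" by force
    have "m' \<in> F" using memory_chain_support[OF mdp update assms(2,3), of g m'] x by simp
    moreover have "g = h" using x(2) inner[of g m'] by (auto split: if_splits)
    ultimately show "x \<in> {h} \<times> F" by simp
  qed (use finite_F in simp)
  also have "\<dots> = (\<Sum>m'\<in>F. pmf (?f (h, m')) (h @ [s], m'') * pmf ?N (h, m'))"
    by (rule sum_singleton_Times)
  also have "\<dots> = (\<Sum>m'\<in>F. path_weight \<tau> m h m' * pmf (\<tau> m' (last h)) (m'', s))"
    unfolding inner by (simp add: path_weight_def mult.commute)
  finally show ?thesis .
qed

lemma history_prob_eq:
  assumes "m \<in> F" "hd h \<in> states M"
  shows "history_prob \<tau> m h = (\<Sum>m'\<in>F. path_weight \<tau> m h m')"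
proof -
  let ?N = "memory_chain \<tau> m (hd h) (length h - 1)"
  have "history_prob \<tau> m h = measure_pmf.prob ?N ({h} \<times> F)"
    unfolding history_prob_def
  proof (rule measure_eq_AE)
    show "AE x in measure_pmf ?N. (x \<in> {h} \<times> UNIV) = (x \<in> {h} \<times> F)"
      using memory_chain_support[OF mdp update assms] by (auto simp: AE_measure_pmf_iff)
  qed auto
  also have "\<dots> = (\<Sum>x\<in>{h} \<times> F. pmf ?N x)"
    using finite_F by (simp add: measure_measure_pmf_finite)
  also have "\<dots> = (\<Sum>m'\<in>F. path_weight \<tau> m h m')"
    unfolding sum_singleton_Times path_weight_def ..
  finally show ?thesis .
qed

text \<open>Markov property at the end of \<open>h\<close>: given the mode there, the chain
  continues as if freshly started. The induction extends the path at its far end, so that the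
  splitting point stays fixed.\<close>

lemma path_weight_append:
  assumes "h \<noteq> []" "m \<in> F" "hd h \<in> states M" "last h \<in> states M"
  shows "path_weight \<tau> m (h @ p) m'' =
    (\<Sum>m'\<in>F. path_weight \<tau> m h m' * path_weight \<tau> m' (last h # p) m'')"
proof (induction p arbitrary: m'' rule: rev_induct)
  case Nil
  have "path_weight \<tau> m h m'' = 0" if "m'' \<notin> F"
    using memory_chain_support[OF mdp update assms(2,3), of h m''] that
    by (auto simp: path_weight_def set_pmf_iff)
  then show ?case using finite_F
    by (auto simp: path_weight_singleton if_distrib sum.delta cong: if_cong)
next
  case (snoc s p)
  have "path_weight \<tau> m (h @ p @ [s]) m'' =
      (\<Sum>k\<in>F. path_weight \<tau> m (h @ p) k * pmf (\<tau> k (last (last h # p))) (m'', s))"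
    using path_weight_snoc[of "h @ p" m s m''] assms by auto
  also have "\<dots> = (\<Sum>k\<in>F. \<Sum>m'\<in>F. path_weight \<tau> m h m' *
      (path_weight \<tau> m' (last h # p) k * pmf (\<tau> k (last (last h # p))) (m'', s)))"
    by (simp add: snoc sum_distrib_right mult.assoc)
  also have "\<dots> = (\<Sum>m'\<in>F. path_weight \<tau> m h m' *
      (\<Sum>k\<in>F. path_weight \<tau> m' (last h # p) k * pmf (\<tau> k (last (last h # p))) (m'', s)))"
    by (subst sum.swap) (simp add: sum_distrib_left)
  also have "\<dots> = (\<Sum>m'\<in>F. path_weight \<tau> m h m' * path_weight \<tau> m' (last h # p @ [s]) m'')"
    using path_weight_snoc[of "last h # p"] assms by (intro sum.cong) auto
  finally show ?case .
qed

lemma history_prob_append: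
  assumes "h \<noteq> []" "m \<in> F" "hd h \<in> states M" "last h \<in> states M"
  shows "history_prob \<tau> m (h @ p) =
    (\<Sum>m'\<in>F. path_weight \<tau> m h m' * history_prob \<tau> m' (last h # p))"
proof -
  have "history_prob \<tau> m (h @ p) = (\<Sum>k\<in>F. \<Sum>m'\<in>F. path_weight \<tau> m h m' * path_weight \<tau> m' (last h # p) k)"
    using assms by (simp add: history_prob_eq path_weight_append)
  also have "\<dots> = (\<Sum>m'\<in>F. path_weight \<tau> m h m' * history_prob \<tau> m' (last h # p))"
    using assms by (subst sum.swap) (simp add: history_prob_eq sum_distrib_left)
  finally show ?thesis .
qed

lemma history_prob_nonneg: "0 \<le> history_prob \<tau> m h"
  by (simp add: history_prob_def)

lemma update_total:
  assumes "m \<in> F" "s \<in> states M" "finite T" "successors M s \<subseteq> T"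
  shows "(\<Sum>t\<in>T. \<Sum>m'\<in>F. pmf (\<tau> m s) (m', t)) = 1"
proof -
  have "(\<Sum>t\<in>T. \<Sum>m'\<in>F. pmf (\<tau> m s) (m', t)) = (\<Sum>x\<in>F \<times> T. pmf (\<tau> m s) x)"
    by (subst sum.swap) (simp add: sum.cartesian_product)
  also have "\<dots> = 1"
    using assms finite_F update by (intro sum_pmf_eq_1) (auto simp: memory_update_def)
  finally show ?thesis .
qed

lemma update_random:
  assumes "m \<in> F" "s \<in> random_states M"
  shows "(\<Sum>m'\<in>F. pmf (\<tau> m s) (m', t)) = pmf (succ_dist M s) t"
proof -
  have s: "s \<in> states M" using assms by (simp add: states_def)
  have "pmf (succ_dist M s) t = pmf (map_pmf snd (\<tau> m s)) t"
    using update assms s by (simp add: memory_update_def)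
  also have "\<dots> = measure_pmf.prob (\<tau> m s) (snd -` {t})" by (rule pmf_map)
  also have "\<dots> = measure_pmf.prob (\<tau> m s) (F \<times> {t})"
  proof (rule measure_eq_AE)
    show "AE x in measure_pmf (\<tau> m s). (x \<in> snd -` {t}) = (x \<in> F \<times> {t})"
      using update assms(1) s by (auto simp: AE_measure_pmf_iff memory_update_def)
  qed auto
  also have "\<dots> = (\<Sum>x\<in>F \<times> {t}. pmf (\<tau> m s) x)"
    using finite_F by (simp add: measure_measure_pmf_finite)
  also have "\<dots> = (\<Sum>m'\<in>F. pmf (\<tau> m s) (m', t))"
    by (rule sum_Times_singleton)
  finally show ?thesis by simp
qed

lemma history_prob_snoc:
  assumes "h \<noteq> []" "m \<in> F" "hd h \<in> states M"
  shows "history_prob \<tau> m (h @ [s]) =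
    (\<Sum>m'\<in>F. path_weight \<tau> m h m' * (\<Sum>m''\<in>F. pmf (\<tau> m' (last h)) (m'', s)))"
  using assms by (simp add: history_prob_eq path_weight_snoc sum_distrib_left) (rule sum.swap)

lemma history_prob_random:
  assumes "h \<noteq> []" "m \<in> F" "hd h \<in> states M" "last h \<in> random_states M"
  shows "history_prob \<tau> m (h @ [s]) = history_prob \<tau> m h * pmf (succ_dist M (last h)) s"
  using assms by (subst history_prob_snoc) (auto simp: update_random history_prob_eq sum_distrib_right)

lemma history_prob_total:
  assumes "h \<noteq> []" "m \<in> F" "hd h \<in> states M" "last h \<in> states M"
    and "finite T" "successors M (last h) \<subseteq> T"
  shows "(\<Sum>s\<in>T. history_prob \<tau> m (h @ [s])) = history_prob \<tau> m h"
proof -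
  have "(\<Sum>s\<in>T. history_prob \<tau> m (h @ [s])) =
      (\<Sum>m'\<in>F. path_weight \<tau> m h m' * (\<Sum>s\<in>T. \<Sum>m''\<in>F. pmf (\<tau> m' (last h)) (m'', s)))"
    using assms by (simp add: history_prob_snoc sum_distrib_left) (rule sum.swap)
  also have "\<dots> = history_prob \<tau> m h"
    using assms by (simp add: update_total history_prob_eq)
  finally show ?thesis .
qed

lemma history_prob_singleton: "history_prob \<tau> m [s] = 1"
  by (simp add: history_prob_def)

lemma history_prob_snoc_le:
  assumes "h \<noteq> []" "m \<in> F" "hd h \<in> states M" "last h \<in> states M"
  shows "history_prob \<tau> m (h @ [s]) \<le> history_prob \<tau> m h"
proof -
  have "(\<Sum>m''\<in>F. pmf (\<tau> m' (last h)) (m'', s)) \<le> 1" for m'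
  proof -
    have "(\<Sum>m''\<in>F. pmf (\<tau> m' (last h)) (m'', s)) = (\<Sum>x\<in>F \<times> {s}. pmf (\<tau> m' (last h)) x)"
      by (rule sum_Times_singleton[symmetric])
    also have "\<dots> = measure_pmf.prob (\<tau> m' (last h)) (F \<times> {s})"
      using finite_F by (simp add: measure_measure_pmf_finite)
    finally show ?thesis by simp
  qed
  then have "history_prob \<tau> m (h @ [s]) \<le> (\<Sum>m'\<in>F. path_weight \<tau> m h m' * 1)"
    using assms by (subst history_prob_snoc) (auto intro!: sum_mono mult_left_mono simp del: mult_1_right)
  then show ?thesis using assms by (simp add: history_prob_eq)
qed

text \<open>The strategy moves with the conditional probabilities of the chain, so the products
  telescope. The assumption on \<sigma> is \<open>implements\<close> restricted to histories from
  \<open>s0\<close>; in this form it also fits the chain obtained by dropping a reward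
  counter.\<close>

lemma prob_cylinder_eq_history_prob:
  assumes m0: "m0 \<in> F" and s0: "s0 \<in> states M"
    and impl: "\<And>h s'. h \<in> partial_runs M \<Longrightarrow> hd h = s0 \<Longrightarrow> last h \<in> controlled M \<Longrightarrow>
      history_prob \<tau> m0 h > 0 \<Longrightarrow> pmf (\<sigma> h) s' = history_prob \<tau> m0 (h @ [s']) / history_prob \<tau> m0 h"
    and "h \<in> partial_runs M" "hd h = s0"
  shows "run_prob M s0 \<sigma> (cylinder h) = history_prob \<tau> m0 h"
  using assms(4,5)
proof (induction h rule: rev_induct)
  case Nil
  then show ?case by (simp add: partial_runs_def)
next
  case (snoc s h)
  show ?case
  proof (cases "h = []")
    case True
    then show ?thesis using snoc by (simp add: prob_cylinder_singleton history_prob_singleton)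
  next
    case False
    have h: "h \<in> partial_runs M" "hd h = s0"
      using snoc.prems False partial_runs_prefix by auto
    then have last: "last h \<in> states M" using False by (auto simp: partial_runs_def)
    note IH = snoc.IH[OF h]
    show ?thesis
    proof (cases "last h \<in> controlled M")
      case True
      show ?thesis
      proof (cases "history_prob \<tau> m0 h > 0")
        case pos: True
        then show ?thesis using impl[OF h True] False True
          by (simp add: prob_cylinder_snoc IH next_dist_def)
      next
        \<comment> \<open>Here \<sigma> is unconstrained, but both sides vanish since extending a
          history cannot raise its probability.\<close>
        case zero: False
        then have "history_prob \<tau> m0 h = 0" using history_prob_nonneg[of m0 h] by linarith
        then show ?thesis
          using history_prob_snoc_le[of h m0 s] history_prob_nonneg[of m0 "h @ [s]"] False m0 s0 h last
          by (simp add: prob_cylinder_snoc IH)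
      qed
    next
      case random: False
      then have "last h \<in> random_states M" using last by (simp add: states_def)
      then show ?thesis using random False m0 s0 h
        by (simp add: prob_cylinder_snoc IH next_dist_def history_prob_random)
    qed
  qed
qed

end

text \<open>If rewards are potential differences, the counter always equals the potential of the
  current state. So \<tau>' can hand this value to \<tau> instead of storing it, and only the finite
  part of the memory remains.\<close>

lemma memory_chain_forget_counter:
  fixes M :: "'s mdp" and F :: "'m set" and m0 :: 'm
  assumes mdp: "mdp M" and s0: "s0 \<in> states M"
    and F: "finite F" "m0 \<in> F"
    and update: "memory_update M (F \<times> UNIV) \<tau>"
    and counter: "\<forall>m\<in>F. \<forall>c. \<forall>s\<in>states M. \<forall>((m', c'), s')\<in>set_pmf (\<tau> (m, c) s). c' = c + reward M s s'"
    and pot: "\<And>s t. (s, t) \<in> edges M \<Longrightarrow> reward M s t = pot t - pot s"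
    and pot0: "pot s0 = (0::real)"
    and \<tau>': "\<And>m s. \<tau>' m s = map_pmf (\<lambda>((m', c'), s'). (m', s')) (\<tau> (m, pot s) s)"
  shows "memory_update M F \<tau>'"
    and "hd h = s0 \<Longrightarrow> history_prob \<tau>' m0 h = history_prob \<tau> (m0, 0) h"
proof -
  show "memory_update M F \<tau>'"
    unfolding memory_update_def
  proof (intro ballI conjI impI)
    fix m s assume *: "m \<in> F" "s \<in> states M"
    then have "(m, pot s) \<in> F \<times> UNIV" by simp
    then have u: "set_pmf (\<tau> (m, pot s) s) \<subseteq> (F \<times> UNIV) \<times> successors M s"
      "s \<in> random_states M \<longrightarrow> map_pmf snd (\<tau> (m, pot s) s) = succ_dist M s"
      using update *(2) unfolding memory_update_def by blast+
    then show "set_pmf (\<tau>' m s) \<subseteq> F \<times> successors M s" by (auto simp: \<tau>')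
    assume "s \<in> random_states M"
    then have "succ_dist M s = map_pmf snd (\<tau> (m, pot s) s)" using u(2) by simp
    then show "map_pmf snd (\<tau>' m s) = succ_dist M s" by (simp add: \<tau>' map_pmf_comp split_def)
  qed
  \<comment> \<open>The counter starts at \<open>0 = pot s0\<close>, and each transition changes
    counter and potential by the same amount.\<close>
  have supp: "m \<in> F \<and> c = pot (last h) \<and> h \<in> partial_runs M"
    if "(h, (m, c)) \<in> set_pmf (memory_chain \<tau> (m0, 0) s0 n)" for n h m c
    using that
  proof (induction n arbitrary: h m c)
    case 0
    then show ?case using F s0 pot0 by (auto simp: partial_runs_def)
  next
    case (Suc n)
    then obtain g k d m2 c2 t where g: "(g, (k, d)) \<in> set_pmf (memory_chain \<tau> (m0, 0) s0 n)"
      "((m2, c2), t) \<in> set_pmf (\<tau> (k, d) (last g))" "h = g @ [t]" "m = m2" "c = c2"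
      by auto
    have IH: "k \<in> F" "d = pot (last g)" "g \<in> partial_runs M" using Suc.IH[OF g(1)] by auto
    have "last g \<in> states M" using IH(3) by (auto simp: partial_runs_def)
    then have m2: "m2 \<in> F" and t: "t \<in> successors M (last g)" and "c2 = d + reward M (last g) t"
      using update counter g(2) IH(1) by (fastforce simp: memory_update_def)+
    moreover have "reward M (last g) t = pot t - pot (last g)" using t pot by (simp add: successors_def)
    ultimately show ?case using partial_runs_snoc[OF mdp IH(3) t] IH g by simp
  qed
  have chain: "memory_chain \<tau>' m0 s0 n =
      map_pmf (\<lambda>(h, (m, c)). (h, m)) (memory_chain \<tau> (m0, 0) s0 n)" for n
  proof (induction n)
    case (Suc n)
    have "memory_chain \<tau>' m0 s0 (Suc n) = bind_pmf (memory_chain \<tau> (m0, 0) s0 n)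
        (\<lambda>(h, (m, c)). map_pmf (\<lambda>(m', s'). (h @ [s'], m')) (\<tau>' m (last h)))"
      by (simp add: Suc bind_map_pmf split_def)
    also have "\<dots> = bind_pmf (memory_chain \<tau> (m0, 0) s0 n)
        (\<lambda>(h, (m, c)). map_pmf (\<lambda>((m', c'), s'). (h @ [s'], m')) (\<tau> (m, c) (last h)))"
      using supp by (intro bind_pmf_cong refl) (auto simp: \<tau>' map_pmf_comp split_def)
    also have "\<dots> = map_pmf (\<lambda>(h, (m, c)). (h, m)) (memory_chain \<tau> (m0, 0) s0 (Suc n))"
      by (simp add: map_bind_pmf map_pmf_comp split_def)
    finally show ?case .
  qed simp
  show "history_prob \<tau>' m0 h = history_prob \<tau> (m0, 0) h" if "hd h = s0"
  proof -
    have "(\<lambda>(h, (m, c)). (h, m)) -` ({h} \<times> UNIV) = ({h} \<times> UNIV :: ('s list \<times> 'm \<times> real) set)"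
      by auto
    then show ?thesis unfolding history_prob_def that chain by simp
  qed
qed

subsection \<open>The MDP\<close>

definition rate :: "nat \<Rightarrow> real" where
  "rate k = (1 / 8) ^ Suc k"

text \<open>This is the reciprocal of \<open>miss_prob k\<close>, so that the miss probabilities of
  the stages with \<open>k\<close> as highest level add up to 1.\<close>

definition block_length :: "nat \<Rightarrow> nat" where
  "block_length k = 2 ^ k * 8 ^ (Suc k * k)"

definition block_start :: "nat \<Rightarrow> nat" where
  "block_start k = (\<Sum>j<k. block_length j)"

definition levels :: "nat \<Rightarrow> nat" where
  "levels n = (LEAST k. n < block_start (Suc k))"

lemma block_length_pos: "0 < block_length k"
  by (simp add: block_length_def)

lemma block_start_Suc: "block_start (Suc k) = block_start k + block_length k"
  by (simp add: block_start_def)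

lemma block_start_ge: "k \<le> block_start k"
proof (induction k)
  case (Suc k)
  then show ?case using block_length_pos[of k] by (simp add: block_start_Suc)
qed simp

lemma block_start_mono: "j \<le> k \<Longrightarrow> block_start j \<le> block_start k"
  by (auto simp: block_start_def intro!: sum_mono2)

lemma levels_ge: "block_start k \<le> n \<Longrightarrow> k \<le> levels n"
  unfolding levels_def
proof (rule LeastI2)
  show "n < block_start (Suc n)" using block_start_ge[of "Suc n"] by simp
  fix j assume "block_start k \<le> n" "n < block_start (Suc j)"
  then show "k \<le> j" using block_start_mono[of "Suc j" k] by linarith
qed

lemma levels_eq: "block_start k \<le> n \<Longrightarrow> n < block_start (Suc k) \<Longrightarrow> levels n = k"
  using levels_ge[of k n] unfolding levels_def by (metis Least_le antisym)

lemma sum_levels: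
  fixes g :: "nat \<Rightarrow> real"
  shows "(\<Sum>n<block_start K. g (levels n)) = (\<Sum>k<K. block_length k * g k)"
proof (induction K)
  case 0
  then show ?case by (simp add: block_start_def)
next
  case (Suc K)
  have "{..<block_start (Suc K)} = {..<block_start K} \<union> {block_start K..<block_start (Suc K)}"
    by (auto simp: block_start_Suc)
  then have "(\<Sum>n<block_start (Suc K). g (levels n)) =
      (\<Sum>n<block_start K. g (levels n)) + (\<Sum>n=block_start K..<block_start (Suc K). g (levels n))"
    by (simp add: sum.union_disjoint ivl_disj_int)
  also have "(\<Sum>n=block_start K..<block_start (Suc K). g (levels n)) =
      (\<Sum>n=block_start K..<block_start (Suc K). g K)"
    by (intro sum.cong) (auto simp: levels_eq)
  finally show ?case by (simp add: Suc block_start_Suc)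
qed

lemma rate_bounds: "0 < rate k" "rate k \<le> 1 / 8" "rate k < 1"
proof -
  have "(1 / 8 :: real) ^ k \<le> 1" by (rule power_le_one) auto
  then show "rate k \<le> 1 / 8" "rate k < 1" by (simp_all add: rate_def)
qed (simp add: rate_def)

text \<open>The factor \<open>(1 / 2) ^ k\<close> bounds the probability of getting as far as a
  given level. Leaving at level \<open>i\<close> costs \<open>k - i\<close> factors
  \<open>rate k\<close>, and a deep dip after an exit before dip \<open>j < i\<close> costs
  \<open>j + 1\<close> more, hence at most \<open>k\<close> in total.\<close>

definition miss_prob :: "nat \<Rightarrow> real" where
  "miss_prob k = (1 / 2) ^ k * rate k ^ k"

lemma miss_prob_pos: "0 < miss_prob k"
  using rate_bounds by (simp add: miss_prob_def)

lemma block_length_miss_prob: "block_length k * miss_prob k = 1"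
  by (simp add: block_length_def miss_prob_def rate_def power_mult[symmetric] power_divide del: power_Suc)

text \<open>Block \<open>k\<close> contributes \<open>k * 2 ^ k * rate k\<close>: all but one factor
  \<open>rate k\<close> are cancelled by the block length. The base 8 in \<open>rate\<close> makes
  this at most \<open>(1 / 2) ^ k\<close>.\<close>

lemma summable_risk: "summable (\<lambda>n. levels n * rate (levels n) ^ Suc (levels n))"
proof (rule bounded_imp_summable)
  show "0 \<le> levels n * rate (levels n) ^ Suc (levels n)" for n
    using rate_bounds[of "levels n"] by simp
  have *: "block_length k * (k * rate k ^ Suc k) \<le> (1 / 2) ^ k" for k
  proof -
    have "block_length k * (k * rate k ^ Suc k) =
        block_length k * miss_prob k * (k * 2 ^ k * rate k)"
      by (simp add: miss_prob_def power_divide)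
    also have "\<dots> = k * 2 ^ k * (1 / 8) ^ Suc k" unfolding block_length_miss_prob by (simp add: rate_def)
    also have "\<dots> \<le> 2 ^ k * 2 ^ k * (1 / 8) ^ k"
    proof -
      have "real k \<le> 2 ^ k" by (metis less_exp less_imp_le of_nat_le_iff of_nat_numeral of_nat_power)
      then show ?thesis by (intro mult_mono) auto
    qed
    also have "\<dots> = (1 / 2) ^ k" by (simp add: power_mult_distrib[symmetric])
    finally show ?thesis .
  qed
  show "(\<Sum>n\<le>N. levels n * rate (levels n) ^ Suc (levels n)) \<le> 2" for N
  proof -
    have "(\<Sum>n\<le>N. levels n * rate (levels n) ^ Suc (levels n)) \<le>
        (\<Sum>n<block_start (Suc N). levels n * rate (levels n) ^ Suc (levels n))"
      using block_start_ge[of "Suc N"] rate_bounds by (intro sum_mono2) (auto simp: less_imp_le)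
    also have "\<dots> = (\<Sum>k<Suc N. block_length k * (k * rate k ^ Suc k))"
      by (rule sum_levels[of "\<lambda>k. k * rate k ^ Suc k"])
    also have "\<dots> \<le> (\<Sum>k<Suc N. (1 / 2) ^ k)" by (intro sum_mono *)
    also have "\<dots> \<le> (\<Sum>k. (1 / 2) ^ k)" by (intro sum_le_suminf) auto
    also have "\<dots> = 2" by (subst suminf_geometric) auto
    finally show ?thesis .
  qed
qed

text \<open>Every block contributes exactly 1.\<close>

lemma not_summable_miss_prob: "\<not> summable (\<lambda>n. miss_prob (levels n))"
proof
  assume s: "summable (\<lambda>n. miss_prob (levels n))"
  obtain K :: nat where K: "(\<Sum>n. miss_prob (levels n)) < K" using reals_Archimedean2 by blast
  have "real K = (\<Sum>n<block_start K. miss_prob (levels n))"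
    by (simp add: sum_levels block_length_miss_prob)
  also have "\<dots> \<le> (\<Sum>n. miss_prob (levels n))"
    using s miss_prob_pos by (intro sum_le_suminf) (auto intro: less_imp_le)
  finally show False using K by simp
qed

section \<open>Time scales: arrival times, depths and delays\<close>

primrec arrival_from :: "nat \<Rightarrow> nat \<Rightarrow> nat \<Rightarrow> nat" where
  "arrival_from n b 0 = b"
| "arrival_from n b (Suc i) =
    arrival_from n b i + 2 + (n + 3) * (2 * arrival_from n b i + 2)"

text \<open>Depths and delays depend on arrival times, and the next stage starts after all of them.
  To avoid this circularity their formulas are written out here; \<open>arrival_Suc\<close> and
  \<open>arrival_0_Suc\<close> recover the readable recursion.\<close>

primrec start_age :: "nat \<Rightarrow> nat" where
  "start_age 0 = 0"
| "start_age (Suc n) = arrival_from n (start_age n) (levels n) + 2 +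
    (\<Sum>j<Suc (levels n). 2 * (2 * arrival_from n (start_age n) j + 2) + 2)"

definition arrival :: "nat \<Rightarrow> nat \<Rightarrow> nat" where
  "arrival n i = arrival_from n (start_age n) i"

text \<open>At level \<open>i\<close> the bottom of dip \<open>i\<close> is reached by time
  \<open>arrival n i + 2 + dips_length n i + depth n i\<close>. By
  \<open>dips_length_le_arrival\<close> this is at most \<open>2 * depth n i\<close>, so the mean
  payoff there is at most -1/2.\<close>

definition depth :: "nat \<Rightarrow> nat \<Rightarrow> nat" where
  "depth n i = 2 * arrival n i + 2"

text \<open>A run that has waited this long can enter dip \<open>i\<close> with its mean payoff
  staying above \<open>- 1 / (n + 3)\<close> or equal to it.\<close>

definition delay :: "nat \<Rightarrow> nat \<Rightarrow> nat" where
  "delay n i = (n + 3) * depth n i"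

text \<open>From \<open>Ctrl n i\<close> to \<open>Ctrl n (Suc i)\<close> there is one step into the
  dip, \<open>2 * depth n i\<close> steps through it and one step out.\<close>

definition dips_length :: "nat \<Rightarrow> nat \<Rightarrow> nat" where
  "dips_length n j = (\<Sum>i<j. 2 * depth n i + 2)"

lemma arrival_Suc: "arrival n (Suc i) = arrival n i + 2 + delay n i"
  by (simp add: arrival_def delay_def depth_def)

lemma arrival_0_Suc:
  "arrival (Suc n) 0 = arrival n (levels n) + 2 + dips_length n (Suc (levels n))"
  by (simp add: arrival_def dips_length_def depth_def)

lemma arrival_mono: "i \<le> j \<Longrightarrow> arrival n i \<le> arrival n j"
  by (induction rule: dec_induct) (auto simp: arrival_Suc)

lemma dips_length_Suc: "dips_length n (Suc j) = dips_length n j + 2 * depth n j + 2"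
  by (simp add: dips_length_def)

lemma dips_length_mono: "i \<le> j \<Longrightarrow> dips_length n i \<le> dips_length n j"
  by (induction rule: dec_induct) (auto simp: dips_length_Suc)

lemma dips_length_strict_mono: "i < j \<Longrightarrow> dips_length n i < dips_length n j"
  using dips_length_mono[of "Suc i" j n] by (simp add: dips_length_Suc)

text \<open>Each delay is at least three times the depth of its dip and so outweighs the descent and
  the ascent.\<close>

lemma dips_length_le_arrival: "dips_length n i \<le> arrival n i"
  by (induction i) (auto simp: dips_length_def arrival_Suc delay_def add_mult_distrib)

lemma depth_pos: "0 < depth n i"
  by (simp add: depth_def)

text \<open>The first index of a node is the stage. In \<open>Delay n i t\<close> and \<open>Dip n j t\<close> the last index
  is the position in a chain of deterministic transitions; \<open>Dip n j (depth n j)\<close> is the bottom of the dip,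
  and \<open>Dip n (levels n)\<close> is the dip that is too deep for every level.\<close>

datatype node =
    Lev nat nat
  | Delay nat nat nat
  | Ctrl nat nat
  | Risk nat nat
  | Dip nat nat nat

instance node :: countable
  by countable_datatype

text \<open>\<open>Ctrl n (levels n)\<close> is reached when all shallow dips have been taken,
  \<open>Ctrl n (Suc (levels n))\<close> after the deepest one. At both the controller has no choice
  left.\<close>

fun valid :: "node \<Rightarrow> bool" where
  "valid (Lev n i) \<longleftrightarrow> i \<le> levels n"
| "valid (Delay n i t) \<longleftrightarrow> i < levels n \<and> t \<le> delay n i"
| "valid (Ctrl n j) \<longleftrightarrow> j \<le> Suc (levels n)"
| "valid (Risk n j) \<longleftrightarrow> j < levels n"
| "valid (Dip n j t) \<longleftrightarrow> j \<le> levels n \<and> t \<le> 2 * depth n j"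

fun is_ctrl :: "node \<Rightarrow> bool" where
  "is_ctrl (Ctrl n j) = True"
| "is_ctrl _ = False"

fun node_next :: "node \<Rightarrow> node set" where
  "node_next (Lev n i) = (if i < levels n then {Ctrl n 0, Delay n i 0} else {Ctrl n 0})"
| "node_next (Delay n i t) = {if t < delay n i then Delay n i (Suc t) else Lev n (Suc i)}"
| "node_next (Ctrl n j) = (if j < levels n then {Risk n j, Dip n j 0} else {Lev (Suc n) 0})"
| "node_next (Risk n j) = {Dip n (levels n) 0, Lev (Suc n) 0}"
| "node_next (Dip n j t) = {if t < 2 * depth n j then Dip n j (Suc t) else Ctrl n (Suc j)}"

definition branch :: "real \<Rightarrow> 'a \<Rightarrow> 'a \<Rightarrow> 'a pmf" where
  "branch q x y = map_pmf (\<lambda>b. if b then x else y) (bernoulli_pmf q)"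

text \<open>At the highest level the exponent is 0, so \<open>Ctrl n 0\<close> is certain and the
  invalid node \<open>Delay n (levels n) 0\<close> gets probability 0. The last equation serves the
  deterministic nodes.\<close>

fun node_dist :: "node \<Rightarrow> node pmf" where
  "node_dist (Lev n i) = branch (rate (levels n) ^ (levels n - i)) (Ctrl n 0) (Delay n i 0)"
| "node_dist (Risk n j) = branch (rate (levels n) ^ Suc j) (Dip n (levels n) 0) (Lev (Suc n) 0)"
| "node_dist x = return_pmf (the_elem (node_next x))"

text \<open>Rewards are differences of this function. Path sums therefore telescope, which makes the
  total reward implicit in the state.\<close>

fun potential :: "node \<Rightarrow> real" where
  "potential (Dip n j t) = - real (min t (2 * depth n j - t))"
| "potential _ = 0"

definition step :: "node \<Rightarrow> node \<Rightarrow> bool" where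
  "step x y \<longleftrightarrow> valid x \<and> y \<in> node_next x"

text \<open>Nodes are coded by natural numbers, and only codes of valid nodes are states.\<close>

definition delay_mdp :: "nat mdp" where
  "delay_mdp =
    \<lparr>controlled = to_nat ` {x. valid x \<and> is_ctrl x},
     random_states = to_nat ` {x. valid x \<and> \<not> is_ctrl x},
     edges = {(to_nat x, to_nat y) |x y. step x y},
     succ_dist = (\<lambda>s. map_pmf to_nat (node_dist (from_nat s))),
     reward = (\<lambda>s t. potential (from_nat t) - potential (from_nat s))\<rparr>"

lemma branch_pmf:
  assumes "0 \<le> q" "q \<le> 1" "x \<noteq> y"
  shows "pmf (branch q x y) z = (if z = x then q else if z = y then 1 - q else 0)"
proof -
  have "pmf (branch q x y) z = measure_pmf.prob (bernoulli_pmf q) ((\<lambda>b. if b then x else y) -` {z})"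
    by (simp add: branch_def pmf_map)
  also have "(\<lambda>b. if b then x else y) -` {z} =
      (if z = x then {True} else if z = y then {False} else {})"
    using assms by (auto split: if_splits)
  finally show ?thesis using assms by (simp add: measure_pmf_single)
qed

lemma rate_power_bounds: "0 < rate k ^ j" "rate k ^ j \<le> 1"
  using rate_bounds[of k] by (auto intro: power_le_one less_imp_le)

lemma pmf_node_dist_Lev:
  "pmf (node_dist (Lev n i)) z = (if z = Ctrl n 0 then rate (levels n) ^ (levels n - i)
    else if z = Delay n i 0 then 1 - rate (levels n) ^ (levels n - i) else 0)"
  using rate_power_bounds by (simp add: branch_pmf less_imp_le)

lemma pmf_node_dist_Risk:
  "pmf (node_dist (Risk n j)) z = (if z = Dip n (levels n) 0 then rate (levels n) ^ Suc j
    else if z = Lev (Suc n) 0 then 1 - rate (levels n) ^ Suc j else 0)"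
  using rate_power_bounds[of "levels n" "Suc j"] by (simp add: branch_pmf less_imp_le)

lemma rate_power_lt: "0 < j \<Longrightarrow> rate k ^ j < 1"
  using rate_bounds[of k] by (simp add: power_Suc_less_one power_less_one_iff less_imp_le)

lemma set_node_dist: "valid x \<Longrightarrow> \<not> is_ctrl x \<Longrightarrow> set_pmf (node_dist x) = node_next x"
proof (cases x)
  case (Lev n i)
  assume "valid x"
  then show ?thesis
    using rate_power_lt[of "levels n - i" "levels n"] rate_power_bounds(1)[of "levels n" "levels n - i"]
      rate_bounds(1)[of "levels n"]
    unfolding Lev by (auto simp: set_pmf_iff pmf_node_dist_Lev simp del: node_dist.simps split: if_splits)
next
  case (Risk n j)
  then show ?thesis
    using rate_power_lt[of "Suc j" "levels n"] rate_power_bounds(1)[of "levels n" "Suc j"]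
    unfolding Risk by (auto simp: set_pmf_iff pmf_node_dist_Risk simp del: node_dist.simps power_Suc split: if_splits)
qed auto

lemma step_valid: "step x y \<Longrightarrow> valid y"
  by (cases x) (auto simp: step_def split: if_splits)

section \<open>Stages and ages of nodes\<close>

fun stage :: "node \<Rightarrow> nat" where
  "stage (Lev n i) = n"
| "stage (Delay n i t) = n"
| "stage (Ctrl n j) = n"
| "stage (Risk n j) = n"
| "stage (Dip n j t) = n"

text \<open>The age of a node bounds the time at which a run from the initial node can visit it.\<close>

fun age :: "node \<Rightarrow> nat" where
  "age (Lev n i) = arrival n i"
| "age (Delay n i t) = arrival n i + 1 + t"
| "age (Ctrl n j) = arrival n (levels n) + 1 + dips_length n j"
| "age (Risk n j) = arrival n (levels n) + 2 + dips_length n j"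
| "age (Dip n j t) = arrival n (levels n) + 2 + dips_length n j + t"

text \<open>The ages of \<open>Ctrl\<close> nodes assume departure from the highest level, so
  earlier departures and early exits only jump ahead. Strict growth gives acyclicity and shows that
  a run visits each node at most once.\<close>

lemma step_age: "step x y \<Longrightarrow> age x < age y"
proof (cases x)
  case (Lev n i)
  assume "step x y"
  then show ?thesis using arrival_mono[of i "levels n" n] Lev
    by (auto simp: step_def dips_length_def split: if_splits)
next
  case (Ctrl n j)
  assume "step x y"
  then show ?thesis using dips_length_mono[of j "Suc (levels n)" n] Ctrl
    by (auto simp: step_def arrival_0_Suc split: if_splits)
next
  case (Risk n j)
  assume "step x y"
  then show ?thesis using dips_length_strict_mono[of j "levels n" n] Risk
    by (auto simp: step_def arrival_0_Suc dips_length_Suc split: if_splits)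
qed (auto simp: step_def arrival_Suc dips_length_Suc split: if_splits)

lemma age_less_next_start: "valid x \<Longrightarrow> age x < arrival (Suc (stage x)) 0"
proof (cases x)
  case (Lev n i)
  assume "valid x"
  then show ?thesis using arrival_mono[of i "levels n" n] Lev by (auto simp: arrival_0_Suc)
next
  case (Delay n i t)
  assume "valid x"
  then show ?thesis using arrival_mono[of "Suc i" "levels n" n] Delay
    by (auto simp: arrival_0_Suc arrival_Suc)
next
  case (Ctrl n j)
  assume "valid x"
  then show ?thesis using dips_length_mono[of j "Suc (levels n)" n] Ctrl by (auto simp: arrival_0_Suc)
next
  case (Risk n j)
  assume "valid x"
  then show ?thesis using dips_length_mono[of j "levels n" n] Risk
    by (auto simp: arrival_0_Suc dips_length_Suc)
next
  case (Dip n j t)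
  assume "valid x"
  then show ?thesis using dips_length_mono[of "Suc j" "Suc (levels n)" n] Dip
    by (auto simp: arrival_0_Suc dips_length_Suc)
qed

lemma step_stage: "step x y \<Longrightarrow> stage y = stage x \<or> y = Lev (Suc (stage x)) 0"
  by (cases x) (auto simp: step_def split: if_splits)

lemma step_potential: "step x y \<Longrightarrow> potential y - potential x \<in> {- 1, 0, 1}"
  by (cases x) (auto simp: step_def min_def split: if_splits)

lemma node_next_card: "finite (node_next x)" "card (node_next x) \<le> 2" "node_next x \<noteq> {}"
  by (cases x; simp add: card_insert_if)+

section \<open>Structural properties of the coded MDP\<close>

definition s_init :: nat where
  "s_init = to_nat (Lev 0 0)"

lemma states_delay_mdp: "states delay_mdp = to_nat ` {x. valid x}"
  by (auto simp: states_def delay_mdp_def)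

lemma s_init_in_states: "s_init \<in> states delay_mdp"
  by (auto simp: states_delay_mdp s_init_def)

lemma edge_iff: "(s, t) \<in> edges delay_mdp \<longleftrightarrow> (\<exists>x y. s = to_nat x \<and> t = to_nat y \<and> step x y)"
  by (auto simp: delay_mdp_def)

lemma edge_to_nat_iff [simp]: "(to_nat x, to_nat y) \<in> edges delay_mdp \<longleftrightarrow> step x y"
  by (auto simp: edge_iff)

lemma reward_delay_mdp:
  "reward delay_mdp s t = potential (from_nat t) - potential (from_nat s)"
  by (simp add: delay_mdp_def)

lemma controlled_to_nat_iff: "to_nat x \<in> controlled delay_mdp \<longleftrightarrow> valid x \<and> is_ctrl x"
  by (auto simp: delay_mdp_def)

lemma random_to_nat_iff: "to_nat x \<in> random_states delay_mdp \<longleftrightarrow> valid x \<and> \<not> is_ctrl x"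
  by (auto simp: delay_mdp_def)

lemma successors_to_nat: "valid x \<Longrightarrow> successors delay_mdp (to_nat x) = to_nat ` node_next x"
  by (auto simp: successors_def edge_iff step_def)

lemma succ_dist_to_nat: "succ_dist delay_mdp (to_nat x) = map_pmf to_nat (node_dist x)"
  by (simp add: delay_mdp_def)

lemma pmf_succ_dist_to_nat:
  "pmf (succ_dist delay_mdp (to_nat x)) (to_nat y) = pmf (node_dist x) y"
  by (simp add: succ_dist_to_nat pmf_map_inj')

lemma mdp_delay_mdp: "mdp delay_mdp"
  unfolding mdp_def
proof (intro conjI ballI)
  show "controlled delay_mdp \<inter> random_states delay_mdp = {}"
    by (auto simp: delay_mdp_def)
  show "edges delay_mdp \<subseteq> states delay_mdp \<times> states delay_mdp"
    by (auto simp: edge_iff states_delay_mdp step_valid) (auto simp: step_def)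
  show "successors delay_mdp s \<noteq> {}" if "s \<in> states delay_mdp" for s
    using that node_next_card by (auto simp: states_delay_mdp successors_to_nat)
  show "set_pmf (succ_dist delay_mdp s) \<subseteq> successors delay_mdp s"
    if "s \<in> random_states delay_mdp" for s
  proof -
    obtain x where x: "s = to_nat x" "valid x" "\<not> is_ctrl x"
      using \<open>s \<in> random_states delay_mdp\<close> by (auto simp: delay_mdp_def)
    show ?thesis unfolding x(1) successors_to_nat[OF x(2)] succ_dist_to_nat set_map_pmf
      using set_node_dist[OF x(2,3)] by simp
  qed
qed simp

lemma acyclic_delay_mdp: "acyclic (edges delay_mdp)"
proof -
  have "age (from_nat s) < age (from_nat t)" if "(s, t) \<in> (edges delay_mdp)\<^sup>+" for s t
    using that by (induction rule: trancl_induct) (auto simp: edge_iff dest!: step_age)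
  then show ?thesis by (force simp: acyclic_def)
qed

lemma total_reward_delay_mdp:
  "h \<noteq> [] \<Longrightarrow> total_reward delay_mdp h = potential (from_nat (last h)) - potential (from_nat (hd h))"
  unfolding total_reward_def reward_delay_mdp
  by (subst sum_lessThan_telescope) (simp add: hd_conv_nth last_conv_nth)

lemma implicit_total_reward_delay_mdp: "implicit_total_reward delay_mdp s"
  by (auto simp: implicit_total_reward_def total_reward_delay_mdp partial_runs_def)

lemma rational_delay_mdp:
  assumes "s \<in> random_states delay_mdp"
  shows "pmf (succ_dist delay_mdp s) t \<in> \<rat>"
proof (cases "t \<in> range (to_nat :: node \<Rightarrow> nat)")
  case True
  then obtain y :: node where t: "t = to_nat y" by auto
  obtain x :: node where s: "s = to_nat x" using assms by (auto simp: delay_mdp_def)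
  have q: "rate k \<in> \<rat>" for k unfolding rate_def by (intro Rats_power Rats_divide) auto
  then have "pmf (node_dist x) y \<in> \<rat>"
  proof (cases x)
    case (Lev n i)
    then show ?thesis using q by (simp add: pmf_node_dist_Lev del: node_dist.simps)
  next
    case (Risk n j)
    then show ?thesis using q by (simp add: pmf_node_dist_Risk del: node_dist.simps power_Suc)
  qed (auto simp: indicator_def)
  then show ?thesis by (simp add: s t pmf_succ_dist_to_nat)
next
  case False
  obtain x :: node where "s = to_nat x" using assms by (auto simp: delay_mdp_def)
  then have "t \<notin> set_pmf (succ_dist delay_mdp s)" using False by (auto simp: succ_dist_to_nat)
  then show ?thesis by (simp add: set_pmf_iff)
qed

lemma successors_delay_mdp:
  assumes "s \<in> states delay_mdp"
  shows "finite (successors delay_mdp s)" "card (successors delay_mdp s) \<le> 2"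
proof -
  obtain x where x: "s = to_nat x" "valid x" using assms by (auto simp: states_delay_mdp)
  then show "finite (successors delay_mdp s)" using node_next_card by (simp add: successors_to_nat)
  show "card (successors delay_mdp s) \<le> 2"
    using x node_next_card[of x] card_image_le[of "node_next x" "to_nat :: node \<Rightarrow> nat"]
    by (simp add: successors_to_nat)
qed

subsection \<open>Runs and their mean payoff\<close>

definition node_run :: "(nat \<Rightarrow> node) \<Rightarrow> bool" where
  "node_run x \<longleftrightarrow> x 0 = Lev 0 0 \<and> (\<forall>t. step (x t) (x (Suc t)))"

lemma node_run_step: "node_run x \<Longrightarrow> step (x t) (x (Suc t))"
  by (simp add: node_run_def)

lemma runs_delay_mdp_iff:
  "\<rho> \<in> runs delay_mdp s_init \<longleftrightarrow> (\<exists>x. node_run x \<and> \<rho> = (\<lambda>t. to_nat (x t)))"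
proof
  assume \<rho>: "\<rho> \<in> runs delay_mdp s_init"
  have "\<exists>y :: node. \<rho> t = to_nat y" for t
    using \<rho> unfolding runs_def edge_iff by blast
  then obtain x :: "nat \<Rightarrow> node" where x: "\<And>t. \<rho> t = to_nat (x t)" by metis
  then have "node_run x" using \<rho> by (simp add: runs_def node_run_def s_init_def)
  then show "\<exists>x. node_run x \<and> \<rho> = (\<lambda>t. to_nat (x t))" using x by blast
qed (auto simp: runs_def node_run_def s_init_def)

lemma node_run_valid: "node_run x \<Longrightarrow> valid (x t)"
  using node_run_step[of x t] by (simp add: step_def)

lemma node_run_age_strict_mono: "node_run x \<Longrightarrow> i < j \<Longrightarrow> age (x i) < age (x j)"
  by (rule lift_Suc_mono_less[of "\<lambda>t. age (x t)"]) (auto intro: step_age node_run_step)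

lemma node_run_inj: "node_run x \<Longrightarrow> x i = x j \<Longrightarrow> i = j"
  using node_run_age_strict_mono[of x i j] node_run_age_strict_mono[of x j i]
  by (cases i j rule: linorder_cases) auto

lemma node_run_time_le_age: "node_run x \<Longrightarrow> t \<le> age (x t)"
proof (induction t)
  case (Suc t)
  then show ?case using step_age[OF node_run_step[of x t]] by linarith
qed simp

lemma node_run_stage_mono: "node_run x \<Longrightarrow> i \<le> j \<Longrightarrow> stage (x i) \<le> stage (x j)"
proof (rule lift_Suc_mono_le[of "\<lambda>t. stage (x t)"])
  show "stage (x t) \<le> stage (x (Suc t))" if "node_run x" for t
    using step_stage[OF node_run_step[OF that, of t]] by auto
qed

lemma start_mono: "m \<le> n \<Longrightarrow> arrival m 0 \<le> arrival n 0"
proof (induction rule: dec_induct)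
  case (step n)
  then show ?case using arrival_mono[of 0 "levels n" n] by (simp add: arrival_0_Suc)
qed simp

text \<open>Time never exceeds age, and ages are bounded within each stage, so a run cannot stay in
  finitely many stages. Stages increase one at a time, and a new one is entered only at its level
  0.\<close>

lemma node_run_visits_stage:
  assumes "node_run x"
  shows "\<exists>t. x t = Lev N 0"
proof (cases N)
  case 0
  then show ?thesis using assms by (auto simp: node_run_def)
next
  case (Suc n)
  have "\<exists>t. N \<le> stage (x t)"
  proof
    let ?t = "arrival N 0"
    have "?t < arrival (Suc (stage (x ?t))) 0"
      using node_run_time_le_age[OF assms, of ?t] age_less_next_start[OF node_run_valid[OF assms, of ?t]]
      by linarith
    then show "N \<le> stage (x ?t)" using start_mono[of "Suc (stage (x ?t))" N] by linarith
  qed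
  then obtain t where t: "N \<le> stage (x t)" "\<And>u. u < t \<Longrightarrow> \<not> N \<le> stage (x u)"
    unfolding exists_least_iff[of "\<lambda>t. N \<le> stage (x t)"] by blast
  have "t \<noteq> 0" using t assms Suc by (metis node_run_def stage.simps(1) not_less_eq_eq zero_le)
  then obtain u where u: "t = Suc u" by (cases t) auto
  have "x t = Lev (Suc (stage (x u))) 0" "Suc (stage (x u)) = N"
    using step_stage[OF node_run_step[OF assms, of u]] t(1) t(2)[of u] u by auto
  then show ?thesis by metis
qed

lemma sum_reward_node_run:
  assumes "node_run x"
  shows "(\<Sum>j<n. reward delay_mdp (to_nat (x j)) (to_nat (x (Suc j)))) = potential (x n)"
proof -
  have "(\<Sum>j<n. potential (x (Suc j)) - potential (x j)) = potential (x n) - potential (x 0)"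
    by (rule sum_lessThan_telescope)
  then show ?thesis using assms by (simp add: reward_delay_mdp node_run_def)
qed

lemma MP_iff:
  assumes "node_run x"
  shows "(\<lambda>t. to_nat (x t)) \<in> MP_liminf_ge_0 delay_mdp s_init \<longleftrightarrow>
    0 \<le> liminf (\<lambda>n. ereal (potential (x n) / real n))"
  using assms by (auto simp: MP_liminf_ge_0_def sum_reward_node_run runs_delay_mdp_iff)

text \<open>The total reward at the bottom is \<open>- depth n i\<close>, so the bound on
  \<open>t\<close> says that the mean payoff is at most -1/2 there.\<close>

definition bad :: "nat \<Rightarrow> (nat \<Rightarrow> nat) set" where
  "bad n = {\<rho>. \<exists>t i. \<rho> t = to_nat (Dip n i (depth n i)) \<and> t \<le> 2 * depth n i}"

text \<open>From some time \<open>T\<close> on the mean payoff exceeds -1/2, and dips of stages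
  beyond the one visited at \<open>T\<close> come later than \<open>T\<close>.\<close>

lemma MP_finitely_many_bad:
  assumes "\<rho> \<in> MP_liminf_ge_0 delay_mdp s_init"
  shows "\<exists>n0. \<forall>n\<ge>n0. \<rho> \<notin> bad n"
proof -
  have "\<rho> \<in> runs delay_mdp s_init" using assms by (simp add: MP_liminf_ge_0_def)
  then obtain x where x: "node_run x" "\<rho> = (\<lambda>t. to_nat (x t))" by (auto simp: runs_delay_mdp_iff)
  have "ereal (- 1 / 2) < liminf (\<lambda>n. ereal (potential (x n) / real n))"
    using assms MP_iff[OF x(1)] unfolding x(2) by (auto intro: less_le_trans[of _ 0])
  from less_LiminfD[OF this] obtain T where T: "\<And>t. T \<le> t \<Longrightarrow> - 1 / 2 < potential (x t) / real t"
    by (auto simp: eventually_sequentially)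
  have "\<rho> \<notin> bad n" if n: "Suc (stage (x T)) \<le> n" for n
  proof
    assume "\<rho> \<in> bad n"
    then obtain t i where t: "x t = Dip n i (depth n i)" "t \<le> 2 * depth n i"
      by (auto simp: bad_def x(2))
    have "T \<le> t" using node_run_stage_mono[OF x(1), of t T] t n by (cases "t \<le> T") auto
    \<comment> \<open>At time 0 the quotient would have the default value 0 and give no
      contradiction.\<close>
    moreover have "0 < t" using t x(1) by (cases t) (auto simp: node_run_def)
    ultimately show False using T[of t] t by (simp add: field_simps)
  qed
  then show ?thesis by blast
qed

text \<open>This is an invariant for induction over time: the current level is still present in the
  past of the run, and the delays of all lower levels have elapsed. Before dip \<open>j\<close> the
  level is at least \<open>j\<close>; by \<open>exit\<close> it differs from \<open>j\<close> when
  the dip is entered, so it is larger, and the invariant passes on to \<open>Ctrl n (Suc j)\<close>.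
  The deepest dip is left out.\<close>

lemma exit_edge_time:
  assumes x: "node_run x"
    and exit: "\<And>t n j. x t = Ctrl n j \<Longrightarrow> x (Suc t) = Dip n j 0 \<Longrightarrow>
      \<not> (\<exists>u<t. x u = Lev n j \<and> x (Suc u) = Ctrl n 0)"
  shows "case x t of
      Lev n i \<Rightarrow> \<forall>j<i. delay n j \<le> t
    | Delay n i s \<Rightarrow> s \<le> t \<and> (\<forall>j<i. delay n j \<le> t)
    | Ctrl n j \<Rightarrow> j \<le> levels n \<longrightarrow>
        (\<exists>i\<ge>j. (\<exists>u<t. x u = Lev n i \<and> x (Suc u) = Ctrl n 0) \<and> (\<forall>j'<i. delay n j' \<le> t))
    | Dip n j s \<Rightarrow> j < levels n \<longrightarrow>
        (\<exists>i>j. (\<exists>u<t. x u = Lev n i \<and> x (Suc u) = Ctrl n 0) \<and> (\<forall>j'<i. delay n j' \<le> t))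
    | Risk n j \<Rightarrow> True"
proof (induction t)
  case 0
  then show ?case using x by (simp add: node_run_def)
next
  case (Suc t)
  have st: "valid (x t)" "x (Suc t) \<in> node_next (x t)"
    using node_run_step[OF x, of t] by (auto simp: step_def)
  show ?case
  proof (cases "x t")
    case (Lev n i)
    then have *: "\<forall>j<i. delay n j \<le> t" using Suc by simp
    have "x (Suc t) = Delay n i 0 \<or> x (Suc t) = Ctrl n 0" using st Lev by (auto split: if_splits)
    then show ?thesis
    proof
      assume "x (Suc t) = Ctrl n 0"
      moreover have "\<exists>u<Suc t. x u = Lev n i \<and> x (Suc u) = Ctrl n 0" using Lev calculation by blast
      moreover have "\<forall>j'<i. delay n j' \<le> Suc t" using * by (auto intro: le_SucI)
      ultimately show ?thesis by auto
    qed (use * in \<open>auto intro: le_SucI\<close>)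
  next
    case (Delay n i s)
    then have *: "s \<le> t" "\<forall>j<i. delay n j \<le> t" using Suc by auto
    then show ?thesis using st Delay by (auto simp: less_Suc_eq intro: le_SucI split: if_splits)
  next
    case (Ctrl n j)
    show ?thesis
    proof (cases "j < levels n")
      case True
      then obtain i where i: "j \<le> i" "\<exists>u<t. x u = Lev n i \<and> x (Suc u) = Ctrl n 0"
          "\<forall>j'<i. delay n j' \<le> t"
        using Suc Ctrl by auto
      consider "x (Suc t) = Risk n j" | "x (Suc t) = Dip n j 0" using st Ctrl True by auto
      then show ?thesis
      proof cases
        case 2
        then have "i \<noteq> j" using exit[OF Ctrl 2] i(2) by auto
        then have "j < i" using i(1) by simp
        then have "\<exists>i>j. (\<exists>u<Suc t. x u = Lev n i \<and> x (Suc u) = Ctrl n 0) \<and> (\<forall>j'<i. delay n j' \<le> Suc t)"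
          using i(2,3) by (meson le_SucI less_SucI)
        then show ?thesis using 2 by simp
      qed simp
    next
      case False
      then show ?thesis using st Ctrl by simp
    qed
  next
    case (Risk n j)
    then show ?thesis using st by auto
  next
    case (Dip n j s)
    show ?thesis
    proof (cases "j < levels n")
      case True
      then obtain i where i: "j < i" "\<exists>u<t. x u = Lev n i \<and> x (Suc u) = Ctrl n 0"
          "\<forall>j'<i. delay n j' \<le> t"
        using Suc Dip by auto
      then have "\<exists>i>j. (\<exists>u<Suc t. x u = Lev n i \<and> x (Suc u) = Ctrl n 0) \<and> (\<forall>j'<i. delay n j' \<le> Suc t)"
        by (meson le_SucI less_SucI)
      then show ?thesis using st Dip by (auto simp: Suc_le_eq split: if_splits)
    next
      case False
      then show ?thesis using st Dip by (auto split: if_splits)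
    qed
  qed
qed

text \<open>Allows the deepest dip to be excluded by excluding its first node alone.\<close>

lemma dip_entered:
  assumes "node_run x" "x t = Dip n j s"
  shows "\<exists>u. x u = Dip n j 0"
  using assms(2)
proof (induction t arbitrary: s)
  case 0
  then show ?case using assms by (simp add: node_run_def)
next
  case (Suc t)
  have "x (Suc t) \<in> node_next (x t)"
    using node_run_step[OF assms(1), of t] by (auto simp: step_def)
  then have "s = 0 \<or> (\<exists>s'. x t = Dip n j s')"
    using Suc.prems by (cases "x t") (auto split: if_splits)
  then show ?case using Suc by blast
qed

text \<open>In late stages a nonzero potential occurs only in shallow dips \<open>j\<close>, which
  by \<open>exit_edge_time\<close> are entered after \<open>delay n j\<close>. The mean payoff then
  differs from 0 by at most \<open>1 / (n + 3)\<close> and tends to 0.\<close>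

lemma MP_if_finitely_many_deep_dips:
  assumes x: "node_run x"
    and exit: "\<And>t n j. x t = Ctrl n j \<Longrightarrow> x (Suc t) = Dip n j 0 \<Longrightarrow>
      \<not> (\<exists>u<t. x u = Lev n j \<and> x (Suc u) = Ctrl n 0)"
    and fin: "\<And>n t. n0 \<le> n \<Longrightarrow> x t \<noteq> Dip n (levels n) 0"
  shows "(\<lambda>t. to_nat (x t)) \<in> MP_liminf_ge_0 delay_mdp s_init"
proof -
  have bound: "\<bar>potential (x t) / real t\<bar> \<le> 1 / (real (stage (x t)) + 3)" if "n0 \<le> stage (x t)" for t
  proof (cases "x t")
    case (Dip n j s)
    have v: "j \<le> levels n" using node_run_valid[OF x, of t] Dip by simp
    have "j \<noteq> levels n"
      using dip_entered[OF x Dip] fin[of n] that Dip by auto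
    then have "delay n j \<le> t" using exit_edge_time[OF x exit, of t] Dip v by force
    then have t: "(real n + 3) * real (depth n j) \<le> real t"
      unfolding delay_def by (metis of_nat_add of_nat_le_iff of_nat_mult of_nat_numeral)
    have "\<bar>potential (x t)\<bar> \<le> real (depth n j)" using Dip by simp
    also have "\<dots> \<le> real t / (real n + 3)" using t by (simp add: field_simps)
    finally have p: "\<bar>potential (x t)\<bar> \<le> real t / (real n + 3)" .
    have "0 < (real n + 3) * real (depth n j)" using depth_pos[of n j] by simp
    then have "0 < real t" using t by linarith
    then show ?thesis using p Dip by (simp add: field_simps)
  qed auto
  have "(\<lambda>t. potential (x t) / real t) \<longlonglongrightarrow> 0"
  proof (rule LIMSEQ_I)
    fix r :: real assume "0 < r"
    then obtain N0 :: nat where N0: "1 / r < real N0" using reals_Archimedean2 by blast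
    define N where "N = max n0 N0"
    obtain T where T: "x T = Lev N 0" using node_run_visits_stage[OF x] by blast
    have "\<bar>potential (x t) / real t\<bar> < r" if "T \<le> t" for t
    proof -
      have s: "N \<le> stage (x t)" using node_run_stage_mono[OF x that] T by simp
      then have "1 / r < real (stage (x t)) + 3" using N0 by (simp add: N_def)
      then have "1 / (real (stage (x t)) + 3) < r" using \<open>0 < r\<close> by (simp add: field_simps)
      then show ?thesis using bound[of t] s by (simp add: N_def)
    qed
    then show "\<exists>no. \<forall>n\<ge>no. norm (potential (x n) / real n - 0) < r" by auto
  qed
  then have "(\<lambda>t. ereal (potential (x t) / real t)) \<longlonglongrightarrow> 0" by (simp add: zero_ereal_def)
  then have "liminf (\<lambda>t. ereal (potential (x t) / real t)) = 0" by (simp add: lim_imp_Liminf)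
  then show ?thesis using MP_iff[OF x] by simp
qed

subsection \<open>A strategy that wins almost surely\<close>

text \<open>Searching the history for \<open>Lev n j\<close> followed by \<open>Ctrl n 0\<close>
  recovers the level, which the current state does not show. \<open>Lev 0 0\<close> is a default
  outside the \<open>Ctrl\<close> nodes.\<close>

definition exit_strategy :: "nat list \<Rightarrow> nat pmf" where
  "exit_strategy h = return_pmf (to_nat (case from_nat (last h) of
      Ctrl n j \<Rightarrow>
        if levels n \<le> j then Lev (Suc n) 0
        else if \<exists>u. Suc u < length h \<and> h ! u = to_nat (Lev n j) \<and> h ! Suc u = to_nat (Ctrl n 0)
        then Risk n j else Dip n j 0
    | _ \<Rightarrow> Lev 0 0))"

lemma exit_strategy_in_strategies: "exit_strategy \<in> strategies delay_mdp"
proof -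
  have "set_pmf (exit_strategy h) \<subseteq> successors delay_mdp (last h)"
    if "last h \<in> controlled delay_mdp" for h
  proof -
    obtain y where y: "last h = to_nat y" "valid y" "is_ctrl y"
      using \<open>last h \<in> controlled delay_mdp\<close> by (auto simp: delay_mdp_def)
    then obtain n j where "y = Ctrl n j" by (cases y) auto
    then show ?thesis using y successors_to_nat[OF y(2)] by (auto simp: exit_strategy_def)
  qed
  then show ?thesis by (simp add: strategies_def)
qed

lemma AE_exit_strategy:
  "AE \<rho> in run_measure delay_mdp s_init exit_strategy. \<exists>x. node_run x \<and> \<rho> = (\<lambda>t. to_nat (x t)) \<and>
    (\<forall>t n j. x t = Ctrl n j \<longrightarrow> j < levels n \<longrightarrow> x (Suc t) =
      (if \<exists>u<t. x u = Lev n j \<and> x (Suc u) = Ctrl n 0 then Risk n j else Dip n j 0))"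
  using AE_runs[OF mdp_delay_mdp s_init_in_states exit_strategy_in_strategies]
    AE_consistent[of s_init delay_mdp exit_strategy]
proof eventually_elim
  case (elim \<rho>)
  then obtain x where x: "node_run x" and \<rho>: "\<rho> = (\<lambda>t. to_nat (x t))"
    by (auto simp: runs_delay_mdp_iff)
  have "x (Suc t) = (if \<exists>u<t. x u = Lev n j \<and> x (Suc u) = Ctrl n 0 then Risk n j else Dip n j 0)"
    if t: "x t = Ctrl n j" "j < levels n" for t n j
  proof -
    have c: "to_nat (x t) \<in> controlled delay_mdp"
      using node_run_valid[OF x, of t] t by (simp add: controlled_to_nat_iff)
    let ?h = "map \<rho> [0..<Suc t]"
    have l: "last ?h = to_nat (x t)" by (simp add: \<rho>)
    have "\<rho> (Suc t) \<in> set_pmf (exit_strategy ?h)"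
      using elim(2)[THEN conjunct2, rule_format, of t] c unfolding next_dist_def l by simp
    moreover have "(\<exists>u. Suc u < length ?h \<and> ?h ! u = to_nat (Lev n j) \<and> ?h ! Suc u = to_nat (Ctrl n 0))
        \<longleftrightarrow> (\<exists>u<t. x u = Lev n j \<and> x (Suc u) = Ctrl n 0)"
      by (auto simp: \<rho> simp del: upt_Suc)
    ultimately show ?thesis
      using t unfolding exit_strategy_def l by (auto simp: \<rho> simp del: upt_Suc split: if_splits)
  qed
  then show ?case using x \<rho> by blast
qed

lemma AE_visit_once:
  assumes "\<sigma> \<in> strategies delay_mdp"
  shows "AE \<rho> in run_measure delay_mdp s_init \<sigma>. \<forall>i j. \<rho> i = s \<and> \<rho> j = s \<longrightarrow> i = j"
  using AE_runs[OF mdp_delay_mdp s_init_in_states assms]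
proof eventually_elim
  case (elim \<rho>)
  then show ?case by (auto simp: runs_delay_mdp_iff dest: node_run_inj)
qed

text \<open>The deepest dip is entered only from some \<open>Risk n j\<close>, and this strategy
  goes there only at level \<open>j\<close>. With \<open>k = levels n\<close>, the probabilities
  \<open>rate k ^ (k - j)\<close> of the level and \<open>rate k ^ Suc j\<close> of the dip multiply
  to a value independent of \<open>j\<close>; there are \<open>k\<close> choices of
  \<open>j\<close>.\<close>

lemma prob_deep_dip:
  "run_prob delay_mdp s_init exit_strategy {\<rho>. \<exists>t. \<rho> t = to_nat (Dip n (levels n) 0)} \<le>
    levels n * rate (levels n) ^ Suc (levels n)"
proof -
  let ?\<mu> = "run_measure delay_mdp s_init exit_strategy"
  let ?P = "run_prob delay_mdp s_init exit_strategy"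
  let ?k = "levels n"
  interpret prob_space ?\<mu> by (rule prob_space_run_measure)
  define E where "E j = {\<rho> :: nat \<Rightarrow> nat. \<exists>t. \<rho> t = to_nat (Risk n j) \<and> \<rho> (Suc t) = to_nat (Dip n ?k 0)}" for j
  define V where "V j = {\<rho> :: nat \<Rightarrow> nat. \<exists>t. \<rho> t = to_nat (Risk n j)}" for j
  define L where "L j = {\<rho> :: nat \<Rightarrow> nat. \<exists>t. \<rho> t = to_nat (Lev n j) \<and> \<rho> (Suc t) = to_nat (Ctrl n 0)}" for j
  have sets [simp, measurable]: "E j \<in> sets ?\<mu>" "V j \<in> sets ?\<mu>" "L j \<in> sets ?\<mu>" for j
    by (rule in_sets_run_measure, simp add: E_def V_def L_def)+
  note once = AE_visit_once[OF exit_strategy_in_strategies]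
  have L: "?P (L j) \<le> rate ?k ^ (?k - j)" for j
  proof -
    have "?P (L j) \<le> pmf (succ_dist delay_mdp (to_nat (Lev n j))) (to_nat (Ctrl n 0)) *
        ?P {\<rho>. \<exists>t. \<rho> t = to_nat (Lev n j)}"
      unfolding L_def by (intro prob_edge_le once) (simp add: controlled_to_nat_iff)
    also have "\<dots> \<le> rate ?k ^ (?k - j) * 1"
      unfolding pmf_succ_dist_to_nat pmf_node_dist_Lev
      using rate_power_bounds(1)[of ?k "?k - j"] by (intro mult_mono) (auto simp: run_prob_def)
    finally show ?thesis by simp
  qed
  \<comment> \<open>Reaching \<open>Risk n j\<close> proves that the strategy found level
    \<open>j\<close> in the history.\<close>
  have V: "?P (V j) \<le> ?P (L j)" for j
    unfolding run_prob_def
  proof (rule finite_measure_mono_AE)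
    show "AE \<rho> in ?\<mu>. \<rho> \<in> V j \<longrightarrow> \<rho> \<in> L j"
      using AE_exit_strategy
    proof eventually_elim
      case (elim \<rho>)
      then obtain x where x: "node_run x" "\<rho> = (\<lambda>t. to_nat (x t))" and
        \<sigma>: "\<And>t n j. x t = Ctrl n j \<Longrightarrow> j < levels n \<Longrightarrow> x (Suc t) =
          (if \<exists>u<t. x u = Lev n j \<and> x (Suc u) = Ctrl n 0 then Risk n j else Dip n j 0)"
        by blast
      show ?case
      proof
        assume "\<rho> \<in> V j"
        then obtain t where t: "x t = Risk n j" by (auto simp: V_def x)
        then obtain u where u: "t = Suc u" using x(1) by (cases t) (auto simp: node_run_def)
        have "step (x u) (Risk n j)" using node_run_step[OF x(1), of u] t u by simp
        then have c: "x u = Ctrl n j" "j < levels n"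
          by (cases "x u"; auto simp: step_def split: if_splits)+
        then have "\<exists>v<u. x v = Lev n j \<and> x (Suc v) = Ctrl n 0"
          using \<sigma>[OF c] t u by (auto split: if_splits)
        then show "\<rho> \<in> L j" by (auto simp: L_def x)
      qed
    qed
  qed simp
  have E: "?P (E j) \<le> rate ?k ^ Suc ?k" if "j < ?k" for j
  proof -
    have "?P (E j) \<le> pmf (succ_dist delay_mdp (to_nat (Risk n j))) (to_nat (Dip n ?k 0)) * ?P (V j)"
      unfolding E_def V_def by (intro prob_edge_le once) (simp add: controlled_to_nat_iff)
    also have "\<dots> \<le> rate ?k ^ Suc j * rate ?k ^ (?k - j)"
      unfolding pmf_succ_dist_to_nat pmf_node_dist_Risk
      using rate_power_bounds(1)[of ?k "Suc j"] order_trans[OF V L, of j]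
      by (intro mult_mono) (auto simp: run_prob_def simp del: power_Suc)
    also have "\<dots> = rate ?k ^ Suc ?k"
      using that by (simp add: power_add[symmetric] del: power_Suc)
    finally show ?thesis .
  qed
  have "?P {\<rho>. \<exists>t. \<rho> t = to_nat (Dip n ?k 0)} \<le> ?P (\<Union>j<?k. E j)"
    unfolding run_prob_def
  proof (rule finite_measure_mono_AE)
    show "AE \<rho> in ?\<mu>. \<rho> \<in> {\<rho>. \<exists>t. \<rho> t = to_nat (Dip n ?k 0)} \<longrightarrow> \<rho> \<in> (\<Union>j<?k. E j)"
      using AE_exit_strategy
    proof eventually_elim
      case (elim \<rho>)
      then obtain x where x: "node_run x" "\<rho> = (\<lambda>t. to_nat (x t))" by blast
      show ?case
      proof
        assume "\<rho> \<in> {\<rho>. \<exists>t. \<rho> t = to_nat (Dip n ?k 0)}"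
        then obtain t where t: "x t = Dip n ?k 0" by (auto simp: x)
        then obtain u where u: "t = Suc u" using x(1) by (cases t) (auto simp: node_run_def)
        have "step (x u) (Dip n ?k 0)" using node_run_step[OF x(1), of u] t u by simp
        then obtain j where "x u = Risk n j" "j < ?k"
          by (cases "x u") (auto simp: step_def split: if_splits)
        then show "\<rho> \<in> (\<Union>j<?k. E j)" using t u by (auto simp: E_def x)
      qed
    qed
  qed auto
  also have "\<dots> \<le> (\<Sum>j<?k. ?P (E j))"
    unfolding run_prob_def by (intro finite_measure_subadditive_finite) auto
  also have "\<dots> \<le> (\<Sum>j<?k. rate ?k ^ Suc ?k)" by (intro sum_mono E) simp
  finally show ?thesis by simp
qed

lemma run_prob_exit_strategy:
  "run_prob delay_mdp s_init exit_strategy (MP_liminf_ge_0 delay_mdp s_init) = 1"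
proof -
  let ?\<mu> = "run_measure delay_mdp s_init exit_strategy"
  interpret prob_space ?\<mu> by (rule prob_space_run_measure)
  define D where "D n = {\<rho> :: nat \<Rightarrow> nat. \<exists>t. \<rho> t = to_nat (Dip n (levels n) 0)}" for n
  have D: "D n \<in> sets ?\<mu>" for n by (rule in_sets_run_measure) (simp add: D_def)
  have "summable (\<lambda>n. measure ?\<mu> (D n))"
    by (rule summable_comparison_test'[OF summable_risk, of 0])
      (use prob_deep_dip in \<open>auto simp: run_prob_def D_def\<close>)
  then have "AE \<rho> in ?\<mu>. eventually (\<lambda>n. \<rho> \<in> space ?\<mu> - D n) sequentially"
    by (intro borel_cantelli_AE1) (auto simp: D emeasure_eq_measure)
  then have "AE \<rho> in ?\<mu>. \<rho> \<in> MP_liminf_ge_0 delay_mdp s_init"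
    using AE_exit_strategy
  proof eventually_elim
    case (elim \<rho>)
    then obtain n0 where n0: "\<And>n. n0 \<le> n \<Longrightarrow> \<rho> \<notin> D n" by (auto simp: eventually_sequentially)
    obtain x where x: "node_run x" "\<rho> = (\<lambda>t. to_nat (x t))" and
      \<sigma>: "\<And>t n j. x t = Ctrl n j \<Longrightarrow> j < levels n \<Longrightarrow> x (Suc t) =
        (if \<exists>u<t. x u = Lev n j \<and> x (Suc u) = Ctrl n 0 then Risk n j else Dip n j 0)"
      using elim(2) by blast
    show ?case unfolding x(2)
    proof (rule MP_if_finitely_many_deep_dips[OF x(1)])
      fix t n j assume t: "x t = Ctrl n j" "x (Suc t) = Dip n j 0"
      then have "j < levels n" using node_run_step[OF x(1), of t] by (auto simp: step_def split: if_splits)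
      then show "\<not> (\<exists>u<t. x u = Lev n j \<and> x (Suc u) = Ctrl n 0)" using \<sigma>[OF t(1)] t(2) by (auto split: if_splits)
    next
      fix n t assume "n0 \<le> n"
      then show "x t \<noteq> Dip n (levels n) 0" using n0[of n] by (auto simp: D_def x)
    qed
  qed
  then show ?thesis
    unfolding run_prob_def using MP_liminf_ge_0_measurable by (intro prob_eq_1[THEN iffD2]) auto
qed

lemma val_delay_mdp: "val delay_mdp s_init (MP_liminf_ge_0 delay_mdp s_init) = 1"
  unfolding val_def
proof (rule antisym)
  have le: "run_prob delay_mdp s_init \<sigma> A \<le> 1" for \<sigma> A
    unfolding run_prob_def by (rule prob_space.prob_le_1[OF prob_space_run_measure])
  show "(SUP \<sigma>\<in>strategies delay_mdp. run_prob delay_mdp s_init \<sigma> (MP_liminf_ge_0 delay_mdp s_init)) \<le> 1"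
    using exit_strategy_in_strategies le by (intro cSUP_least) auto
  show "1 \<le> (SUP \<sigma>\<in>strategies delay_mdp. run_prob delay_mdp s_init \<sigma> (MP_liminf_ge_0 delay_mdp s_init))"
    using exit_strategy_in_strategies le run_prob_exit_strategy
    by (intro cSUP_upper2[of _ _ exit_strategy]) (auto intro!: bdd_aboveI2[of _ _ 1])
qed

subsection \<open>Paths that defeat finite memory\<close>

primrec lev_path :: "nat \<Rightarrow> nat \<Rightarrow> node list" where
  "lev_path n 0 = [Lev n 0]"
| "lev_path n (Suc i) = lev_path n i @ map (Delay n i) [0..<Suc (delay n i)] @ [Lev n (Suc i)]"

primrec ctrl_path :: "nat \<Rightarrow> nat \<Rightarrow> node list" where
  "ctrl_path n 0 = [Ctrl n 0]"
| "ctrl_path n (Suc j) = ctrl_path n j @ map (Dip n j) [0..<Suc (2 * depth n j)] @ [Ctrl n (Suc j)]"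

text \<open>Stage \<open>n\<close> left by the random player at level \<open>i\<close>: the controller either exits at \<open>j \<le> i\<close>
  and is hit by the deepest dip, or (index \<open>j = i + 1\<close>) enters dip \<open>i\<close>. In both cases the path ends
  at the bottom of a dip that is too deep for the time elapsed.\<close>

definition miss_path :: "nat \<Rightarrow> nat \<Rightarrow> nat \<Rightarrow> node list" where
  "miss_path n i j = lev_path n i @
    (if j \<le> i then ctrl_path n j @ [Risk n j] @ map (Dip n (levels n)) [0..<Suc (depth n (levels n))]
     else ctrl_path n i @ map (Dip n i) [0..<Suc (depth n i)])"

text \<open>The condition on \<open>min i j\<close> removes \<open>(k, k)\<close> and
  \<open>(k, Suc k)\<close>, since the controller has no choice at \<open>Ctrl n k\<close>.\<close>

definition miss_index :: "nat \<Rightarrow> (nat \<times> nat) set" where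
  "miss_index k = {(i, j). i \<le> k \<and> j \<le> Suc i \<and> min i j < k}"

lemma finite_miss_index: "finite (miss_index k)"
  by (rule finite_subset[of _ "{..k} \<times> {..Suc k}"]) (auto simp: miss_index_def)

lemma lev_path_hd: "\<exists>q. lev_path n i = Lev n 0 # q"
  by (induction i) auto

lemma lev_path_last: "\<exists>q. lev_path n i = q @ [Lev n i]"
  by (cases i) auto

lemma ctrl_path_hd: "\<exists>q. ctrl_path n j = Ctrl n 0 # q"
  by (induction j) auto

lemma ctrl_path_last: "\<exists>q. ctrl_path n j = q @ [Ctrl n j]"
  by (cases j) auto

lemma length_ctrl_path: "length (ctrl_path n j) = Suc (dips_length n j)"
  by (induction j) (auto simp: dips_length_def)

text \<open>Paths are compared through the edges they contain, which avoids computing positions from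
  depths and delays.\<close>

definition consecutive :: "'a \<Rightarrow> 'a \<Rightarrow> 'a list \<Rightarrow> bool" where
  "consecutive u v l \<longleftrightarrow> (\<exists>a b. l = a @ u # v # b)"

lemma consecutive_append: "consecutive u v l \<Longrightarrow> consecutive u v (l @ b)" "consecutive u v l \<Longrightarrow> consecutive u v (a @ l)"
  unfolding consecutive_def by (metis append_assoc append_Cons)+

lemma consecutive_lev_ctrl: "consecutive (Lev n i) (Ctrl n 0) (lev_path n i @ ctrl_path n j @ q)"
  using lev_path_last[of n i] ctrl_path_hd[of n j] by (force simp: consecutive_def)

lemma consecutive_ctrl_next: "consecutive (Ctrl n j) y (ctrl_path n j @ y # q)"
  using ctrl_path_last[of n j] by (force simp: consecutive_def)

lemma map_upt_Suc: "map f [0..<Suc N] = f 0 # map f [Suc 0..<Suc N]"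
  by (simp add: upt_conv_Cons del: upt_Suc)

lemma consecutive_ctrl_dip:
  "j \<le> i \<Longrightarrow> consecutive (Ctrl n j) (Dip n j 0) (ctrl_path n i @ map (Dip n i) [0..<Suc N])"
proof (induction i arbitrary: N)
  case 0
  then show ?case using consecutive_ctrl_next[of n 0 "Dip n 0 0"] by (simp add: map_upt_Suc del: upt_Suc)
next
  case (Suc i)
  show ?case
  proof (cases "j = Suc i")
    case True
    then show ?thesis using consecutive_ctrl_next[of n "Suc i" "Dip n (Suc i) 0"]
      by (simp add: map_upt_Suc del: upt_Suc ctrl_path.simps)
  next
    case False
    then have "consecutive (Ctrl n j) (Dip n j 0) (ctrl_path n i @ map (Dip n i) [0..<Suc (2 * depth n i)])"
      using Suc by simp
    from consecutive_append(1)[OF this] show ?thesis by (simp del: upt_Suc)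
  qed
qed

lemma consecutive_miss_path:
  shows "consecutive (Lev n i) (Ctrl n 0) (miss_path n i j)"
    and "j \<le> i \<Longrightarrow> consecutive (Ctrl n j) (Risk n j) (miss_path n i j)"
    and "j \<le> i \<Longrightarrow> consecutive (Risk n j) (Dip n (levels n) 0) (miss_path n i j)"
    and "i < j \<Longrightarrow> j' \<le> i \<Longrightarrow> consecutive (Ctrl n j') (Dip n j' 0) (miss_path n i j)"
proof -
  show "consecutive (Lev n i) (Ctrl n 0) (miss_path n i j)"
    unfolding miss_path_def by (auto simp del: upt_Suc intro: consecutive_lev_ctrl)
  show "consecutive (Ctrl n j) (Risk n j) (miss_path n i j)" if "j \<le> i"
    using that consecutive_append(2)[OF consecutive_ctrl_next[of n j "Risk n j"], of "lev_path n i"]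
    unfolding miss_path_def by (simp del: upt_Suc)
  show "consecutive (Risk n j) (Dip n (levels n) 0) (miss_path n i j)" if "j \<le> i"
    using that unfolding miss_path_def consecutive_def map_upt_Suc
    by (intro exI[of _ "lev_path n i @ ctrl_path n j"] exI) simp
  show "consecutive (Ctrl n j') (Dip n j' 0) (miss_path n i j)" if "i < j" "j' \<le> i"
    using that consecutive_append(2)[OF consecutive_ctrl_dip[OF that(2), of n "depth n i"], of "lev_path n i"]
    unfolding miss_path_def by (simp del: upt_Suc)
qed

lemma cylinder_consecutive:
  assumes "(\<lambda>t. to_nat (x t)) \<in> cylinder (h @ map to_nat l)" "consecutive (u :: node) v l"
  shows "\<exists>t. x t = u \<and> x (Suc t) = v"
proof -
  obtain a b where l: "l = a @ u # v # b" using assms(2) by (auto simp: consecutive_def)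
  let ?t = "length h + length a"
  have "to_nat (x i) = (h @ map to_nat l) ! i" if "i < length h + length l" for i
    using assms(1) that by (auto simp: cylinder_def)
  from this[of ?t] this[of "Suc ?t"] have "x ?t = u" "x (Suc ?t) = v"
    by (auto simp: l nth_append)
  then show ?thesis by blast
qed

text \<open>A run visits each node once, so predecessors and successors in it are unique. The
  predecessor of \<open>Ctrl n 0\<close> determines the level; the predecessor of the first node of
  the deepest dip determines the exit; the successor of \<open>Ctrl n j\<close> separates an exit at
  \<open>j\<close> from walking on.\<close>

lemma miss_path_cylinders_disjoint:
  assumes x: "node_run x"
    and 1: "(\<lambda>t. to_nat (x t)) \<in> cylinder (h @ map to_nat (miss_path n i j))" "j \<le> Suc i"
    and 2: "(\<lambda>t. to_nat (x t)) \<in> cylinder (h @ map to_nat (miss_path n i' j'))" "j' \<le> Suc i'"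
  shows "i = i' \<and> j = j'"
proof -
  have pred: "u = u'" if "x t = u" "x (Suc t) = v" "x t' = u'" "x (Suc t') = v" for t t' u u' v
    using node_run_inj[OF x, of "Suc t" "Suc t'"] that by auto
  have succ: "v = v'" if "x t = u" "x (Suc t) = v" "x t' = u" "x (Suc t') = v'" for t t' u v v'
    using node_run_inj[OF x, of t t'] that by auto
  note c1 = cylinder_consecutive[OF 1(1)] and c2 = cylinder_consecutive[OF 2(1)]
  have i: "i = i'"
    using c1[OF consecutive_miss_path(1)] c2[OF consecutive_miss_path(1)] pred by blast
  consider "j \<le> i" "j' \<le> i" | "j \<le> i" "i < j'" | "i < j" "j' \<le> i" | "i < j" "i < j'" by linarith
  then show ?thesis
  proof cases
    case 1
    then show ?thesis
      using c1[OF consecutive_miss_path(3)] c2[OF consecutive_miss_path(3)] pred i by blast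
  next
    case 2
    then show ?thesis
      using c1[OF consecutive_miss_path(2)] c2[OF consecutive_miss_path(4), of j] succ i by blast
  next
    case 3
    then show ?thesis
      using c2[OF consecutive_miss_path(2)] c1[OF consecutive_miss_path(4), of j'] succ i by blast
  next
    case 4
    then show ?thesis using assms i by auto
  qed
qed

text \<open>For the deepest dip the age of its bottom is a good enough time bound. For dip
  \<open>i\<close> at level \<open>i\<close> ages are too coarse, as they allow for the highest
  level, so time is counted from \<open>Lev n i\<close> along the path.\<close>

lemma miss_path_bad:
  assumes x: "node_run x"
    and c: "(\<lambda>t. to_nat (x t)) \<in> cylinder (h @ map to_nat (miss_path n i j))"
  shows "(\<lambda>t. to_nat (x t)) \<in> bad n"
proof -
  have at: "x (length h + t) = miss_path n i j ! t" if "t < length (miss_path n i j)" for t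
    using c[unfolded cylinder_def] that by (auto dest!: spec[of _ "length h + t"])
  obtain q where q: "lev_path n i = q @ [Lev n i]" using lev_path_last by blast
  show ?thesis
  proof (cases "j \<le> i")
    case True
    let ?k = "levels n"
    define l where "l = lev_path n i @ ctrl_path n j @ [Risk n j] @ map (Dip n ?k) [0..<depth n ?k]"
    have l: "miss_path n i j = l @ [Dip n ?k (depth n ?k)]" using True by (simp add: miss_path_def l_def)
    let ?t = "length h + length l"
    have t: "x ?t = Dip n ?k (depth n ?k)" using at[of "length l"] by (simp add: l)
    have "?t \<le> 2 * depth n ?k"
      using node_run_time_le_age[OF x, of ?t] dips_length_le_arrival[of n ?k]
      unfolding t by (simp add: depth_def)
    then show ?thesis unfolding bad_def using t by auto
  next
    case False
    define l where "l = lev_path n i @ ctrl_path n i @ map (Dip n i) [0..<depth n i]"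
    have l: "miss_path n i j = l @ [Dip n i (depth n i)]" using False by (simp add: miss_path_def l_def)
    let ?t = "length h + length l"
    have t: "x ?t = Dip n i (depth n i)" using at[of "length l"] by (simp add: l)
    have "x (length h + length q) = Lev n i" using at[of "length q"] by (simp add: l l_def q nth_append)
    then have "length h + length q \<le> arrival n i"
      using node_run_time_le_age[OF x, of "length h + length q"] by simp
    then have "?t \<le> 2 * depth n i"
      using dips_length_le_arrival[of n i]
      by (simp add: l_def q length_ctrl_path depth_def)
    then show ?thesis unfolding bad_def using t by auto
  qed
qed

section \<open>Lower bounds on the weights of paths within a stage\<close>

locale delay_memory = finite_memory delay_mdp F \<tau> for F :: "'m set" and \<tau>
begin

abbreviation weight :: "'m \<Rightarrow> node list \<Rightarrow> real" where
  "weight m l \<equiv> history_prob \<tau> m (map to_nat l)"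

lemma hd_map_state: "l \<noteq> [] \<Longrightarrow> valid (hd l) \<Longrightarrow> hd (map to_nat l) \<in> states delay_mdp"
  by (simp add: hd_map states_delay_mdp)

lemma weight_random:
  assumes "m \<in> F" "valid (hd (l @ [x]))" "valid x" "\<not> is_ctrl x"
  shows "weight m (l @ [x, y]) = weight m (l @ [x]) * pmf (node_dist x) y"
  using history_prob_random[of "map to_nat (l @ [x])" m "to_nat y"] hd_map_state[of "l @ [x]"] assms
  by (simp add: random_to_nat_iff pmf_succ_dist_to_nat)

lemma weight_ctrl:
  assumes "m \<in> F" "valid (hd (l @ [Ctrl n j]))" "j < levels n"
  shows "weight m (l @ [Ctrl n j, Risk n j]) + weight m (l @ [Ctrl n j, Dip n j 0]) = weight m (l @ [Ctrl n j])"
proof -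
  let ?h = "map to_nat (l @ [Ctrl n j])"
  have "(\<Sum>s\<in>{to_nat (Risk n j), to_nat (Dip n j 0)}. history_prob \<tau> m (?h @ [s])) = history_prob \<tau> m ?h"
    using assms hd_map_state[of "l @ [Ctrl n j]"]
    by (intro history_prob_total) (auto simp: states_delay_mdp successors_to_nat)
  then show ?thesis by simp
qed

lemma weight_chain:
  assumes "m \<in> F" "valid (hd (l @ [f 0]))"
    and f: "\<And>t. t < N \<Longrightarrow> valid (f t) \<and> \<not> is_ctrl (f t) \<and> pmf (node_dist (f t)) (f (Suc t)) = 1"
  shows "weight m (l @ map f [0..<Suc N]) = weight m (l @ [f 0])"
  using f
proof (induction N)
  case (Suc N)
  have e: "map f [0..<Suc (Suc N)] = map f [0..<N] @ [f N, f (Suc N)]" by simp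
  have hd: "valid (hd ((l @ map f [0..<N]) @ [f N]))"
    using assms(2) by (cases "l = []"; cases N) (auto simp: map_upt_Suc simp del: upt_Suc)
  have "weight m (l @ map f [0..<Suc (Suc N)]) =
      weight m ((l @ map f [0..<N]) @ [f N]) * pmf (node_dist (f N)) (f (Suc N))"
    unfolding e using weight_random[OF assms(1) hd, of "f (Suc N)"] Suc.prems[of N] by simp
  also have "\<dots> = weight m (l @ map f [0..<Suc N])" using Suc.prems[of N] by simp
  also have "\<dots> = weight m (l @ [f 0])" by (intro Suc) (use Suc.prems in auto)
  finally show ?case .
qed simp

lemma hd_lev_path [simp]: "hd (lev_path n i @ q) = Lev n 0"
  using lev_path_hd[of n i] by auto

lemma hd_ctrl_path [simp]: "hd (ctrl_path n i @ q) = Ctrl n 0"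
  using ctrl_path_hd[of n i] by auto

text \<open>Below the highest level the probability of leaving is at most
  \<open>rate (levels n)\<close>, so each further level is reached with probability at least 1/2;
  the delays are passed with certainty.\<close>

lemma weight_lev_path:
  assumes "m \<in> F" "i \<le> levels n"
  shows "(1 / 2) ^ i \<le> weight m (lev_path n i)"
  using assms(2)
proof (induction i)
  case 0
  then show ?case by (simp add: history_prob_singleton)
next
  case (Suc i)
  obtain q where q: "lev_path n i = q @ [Lev n i]" using lev_path_last by blast
  have hq: "hd (q @ [Lev n i]) = Lev n 0" using hd_lev_path[of n i "[]"] q by simp
  have hq2: "hd (q @ Lev n i # r) = Lev n 0" for r using hd_lev_path[of n i r] q by simp
  let ?D = "map (Delay n i) [0..<Suc (delay n i)]"
  have d: "?D = map (Delay n i) [0..<delay n i] @ [Delay n i (delay n i)]" by simp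
  have "weight m (lev_path n (Suc i)) = weight m (lev_path n i @ ?D)"
    using weight_random[of m "lev_path n i @ map (Delay n i) [0..<delay n i]" "Delay n i (delay n i)" "Lev n (Suc i)"]
      assms(1) Suc.prems by simp
  also have "\<dots> = weight m (lev_path n i @ [Delay n i 0])"
    using assms(1) Suc.prems by (intro weight_chain) auto
  also have "\<dots> = weight m (lev_path n i) * (1 - rate (levels n) ^ (levels n - i))"
    using weight_random[of m q "Lev n i" "Delay n i 0"] assms(1) Suc.prems
    unfolding q pmf_node_dist_Lev by (simp add: hq)
  also have "\<dots> \<ge> (1 / 2) ^ i * (1 / 2)"
  proof (rule mult_mono)
    have "rate (levels n) ^ (levels n - i) \<le> rate (levels n) ^ 1"
      using rate_bounds[of "levels n"] Suc.prems by (intro power_decreasing) auto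
    then show "1 / 2 \<le> 1 - rate (levels n) ^ (levels n - i)"
      using rate_bounds[of "levels n"] by simp
  qed (use Suc history_prob_nonneg in auto)
  finally show ?case by simp
qed

lemma weight_lev_exit:
  assumes "m \<in> F" "i \<le> levels n"
  shows "(1 / 2) ^ levels n * rate (levels n) ^ (levels n - i) \<le> weight m (lev_path n i @ [Ctrl n 0])"
proof -
  obtain q where q: "lev_path n i = q @ [Lev n i]" using lev_path_last by blast
  have hq: "hd (q @ [Lev n i]) = Lev n 0" using hd_lev_path[of n i "[]"] q by simp
  have "weight m (lev_path n i @ [Ctrl n 0]) = weight m (lev_path n i) * rate (levels n) ^ (levels n - i)"
    using weight_random[of m q "Lev n i" "Ctrl n 0"] assms
    unfolding q pmf_node_dist_Lev by (simp add: hq)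
  moreover have "(1 / 2 :: real) ^ levels n \<le> weight m (lev_path n i)"
    using assms(2) by (intro order_trans[OF power_decreasing weight_lev_path[OF assms]]) auto
  ultimately show ?thesis
    using rate_power_bounds(1)[of "levels n" "levels n - i"] by (simp add: mult_right_mono)
qed

lemma weight_ctrl_path_Suc:
  assumes "m \<in> F" "j < levels n"
  shows "weight m (ctrl_path n (Suc j)) = weight m (ctrl_path n j @ [Dip n j 0])"
proof -
  let ?D = "map (Dip n j) [0..<Suc (2 * depth n j)]"
  have "weight m (ctrl_path n (Suc j)) = weight m (ctrl_path n j @ ?D)"
    using weight_random[of m "ctrl_path n j @ map (Dip n j) [0..<2 * depth n j]" "Dip n j (2 * depth n j)" "Ctrl n (Suc j)"]
      assms by simp
  also have "\<dots> = weight m (ctrl_path n j @ [Dip n j 0])"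
    using assms by (intro weight_chain) auto
  finally show ?thesis .
qed

lemma weight_ctrl_split:
  assumes "m \<in> F" "j < levels n"
  shows "weight m (ctrl_path n j @ [Risk n j]) + weight m (ctrl_path n j @ [Dip n j 0]) = weight m (ctrl_path n j)"
proof -
  obtain q where q: "ctrl_path n j = q @ [Ctrl n j]" using ctrl_path_last by blast
  have hq: "hd (q @ [Ctrl n j]) = Ctrl n 0" using hd_ctrl_path[of n j "[]"] q by simp
  show ?thesis using weight_ctrl[of m q n j] assms unfolding q by (simp add: hq)
qed

text \<open>A walk from \<open>Ctrl n 0\<close> either exits before one of the dips up to
  \<open>i\<close> or enters dip \<open>i\<close>, because a dip once entered leads surely to the
  next choice.\<close>

lemma sum_exit_weights:
  assumes "m \<in> F" "i < levels n"
  shows "(\<Sum>j\<le>i. weight m (ctrl_path n j @ [Risk n j])) + weight m (ctrl_path n i @ [Dip n i 0]) = 1"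
  using assms(2)
proof (induction i)
  case 0
  then show ?case using weight_ctrl_split[OF assms(1), of 0 n] by (simp add: history_prob_singleton)
next
  case (Suc i)
  then show ?case
    using weight_ctrl_split[OF assms(1), of "Suc i" n] weight_ctrl_path_Suc[OF assms(1), of i n]
    by (simp del: ctrl_path.simps)
qed

lemma weight_shallow:
  assumes "m \<in> F" "i < levels n"
  shows "weight m (ctrl_path n i @ map (Dip n i) [0..<Suc (depth n i)]) = weight m (ctrl_path n i @ [Dip n i 0])"
  using assms by (intro weight_chain) auto

lemma weight_deep:
  assumes "m \<in> F" "j < levels n"
  shows "weight m (ctrl_path n j @ [Risk n j] @ map (Dip n (levels n)) [0..<Suc (depth n (levels n))]) =
    rate (levels n) ^ Suc j * weight m (ctrl_path n j @ [Risk n j])"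
proof -
  have "weight m ((ctrl_path n j @ [Risk n j]) @ map (Dip n (levels n)) [0..<Suc (depth n (levels n))]) =
      weight m ((ctrl_path n j @ [Risk n j]) @ [Dip n (levels n) 0])"
    using assms by (intro weight_chain) auto
  also have "\<dots> = weight m (ctrl_path n j @ [Risk n j]) * rate (levels n) ^ Suc j"
    using weight_random[of m "ctrl_path n j" "Risk n j" "Dip n (levels n) 0"] assms
    unfolding pmf_node_dist_Risk by simp
  finally show ?thesis by (simp add: mult.commute)
qed

text \<open>With more levels than memory modes, two levels \<open>i < i'\<close> are likely to leave the memory in the
  same mode \<open>m'\<close> when the controller starts to choose. From there, entering dip \<open>i\<close> is a mistake at
  level \<open>i\<close>, and exiting at some \<open>j \<le> i\<close> is needlessly risky at level \<open>i'\<close>.\<close>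

lemma sum_miss_weights:
  assumes m: "m \<in> F" and card: "card F \<le> levels n"
  shows "miss_prob (levels n) / card F \<le> (\<Sum>(i, j)\<in>miss_index (levels n). weight m (miss_path n i j))"
proof -
  let ?k = "levels n"
  let ?r = "rate ?k"
  define \<alpha> where "\<alpha> i = path_weight \<tau> m (map to_nat (lev_path n i @ [Ctrl n 0]))" for i
  define p where "p i = (1 / 2) ^ ?k * ?r ^ (?k - i)" for i
  have cF: "0 < card F" using m finite_F by (auto simp: card_gt_0_iff)
  have st: "hd (map to_nat (lev_path n i @ [Ctrl n 0])) \<in> states delay_mdp" for i
    by (rule hd_map_state) simp_all
  \<comment> \<open>Some mode carries at least the average share of the probability of leaving at
    level \<open>i\<close>.\<close>
  have "\<exists>m'\<in>F. p i / card F \<le> \<alpha> i m'" if "i \<le> ?k" for i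
  proof (rule ccontr)
    assume "\<not> ?thesis"
    then have "(\<Sum>m'\<in>F. \<alpha> i m') < (\<Sum>m'\<in>F. p i / card F)"
      using finite_F m by (intro sum_strict_mono) auto
    also have "\<dots> = p i" using cF by simp
    also have "p i \<le> (\<Sum>m'\<in>F. \<alpha> i m')"
      using weight_lev_exit[OF m that] history_prob_eq[OF m st, of i] by (simp add: p_def \<alpha>_def)
    finally show False by simp
  qed
  then obtain f where f: "\<And>i. i \<le> ?k \<Longrightarrow> f i \<in> F \<and> p i / card F \<le> \<alpha> i (f i)" by metis
  \<comment> \<open>Pigeonhole: there are \<open>?k + 1\<close> levels but at most \<open>?k\<close>
    modes.\<close>
  have "\<not> inj_on f {..?k}"
  proof
    assume "inj_on f {..?k}"
    then have "card {..?k} \<le> card F" using f finite_F by (intro card_inj_on_le[of f]) auto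
    then show False using card by simp
  qed
  then obtain a b where ab: "a \<le> ?k" "b \<le> ?k" "f a = f b" "a \<noteq> b" by (auto simp: inj_on_def)
  then obtain i i' where i: "i < i'" "i' \<le> ?k" "f i = f i'"
    by (cases a b rule: linorder_cases) (use that in auto)
  define m' where "m' = f i"
  have m': "m' \<in> F" "p i / card F \<le> \<alpha> i m'" "p i' / card F \<le> \<alpha> i' m'"
    using f[of i] f[of i'] i by (auto simp: m'_def)
  \<comment> \<open>Splits the path at \<open>Ctrl n 0\<close> and keeps only the contribution of
    the common mode.\<close>
  have join: "\<alpha> l m' * weight m' (ctrl_path n j @ q) \<le> weight m (lev_path n l @ ctrl_path n j @ q)" for l j q
  proof -
    obtain c where c: "ctrl_path n j = Ctrl n 0 # c" using ctrl_path_hd by blast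
    have "weight m (lev_path n l @ ctrl_path n j @ q) =
        (\<Sum>k\<in>F. \<alpha> l k * weight k (ctrl_path n j @ q))"
      using history_prob_append[OF _ m st, of l "map to_nat (c @ q)"]
      by (simp add: c \<alpha>_def states_delay_mdp)
    moreover have "\<alpha> l m' * weight m' (ctrl_path n j @ q) \<le> (\<Sum>k\<in>F. \<alpha> l k * weight k (ctrl_path n j @ q))"
      using m'(1) finite_F by (intro member_le_sum) (auto simp: \<alpha>_def history_prob_nonneg)
    ultimately show ?thesis by simp
  qed
  define c where "c = weight m' (ctrl_path n i @ [Dip n i 0])"
  define e where "e j = weight m' (ctrl_path n j @ [Risk n j])" for j
  have nonneg: "0 \<le> c" "0 \<le> e j" for j by (auto simp: c_def e_def history_prob_nonneg)
  have ec: "(\<Sum>j\<le>i. e j) = 1 - c"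
    using sum_exit_weights[OF m'(1), of i n] i by (simp add: c_def e_def)
  \<comment> \<open>A departure at level \<open>l\<close> leaves room for \<open>l\<close> further
    factors of the rate.\<close>
  have miss: "miss_prob ?k \<le> p l * ?r ^ t" if "?k - l + t \<le> ?k" for l t
  proof -
    have "?r ^ ?k \<le> ?r ^ (?k - l + t)"
      using that rate_bounds[of ?k] by (intro power_decreasing) auto
    then show ?thesis by (simp add: p_def miss_prob_def power_add)
  qed
  have 1: "miss_prob ?k / card F * c \<le> weight m (miss_path n i (Suc i))"
  proof -
    have "miss_prob ?k / card F * c \<le> \<alpha> i m' * c"
      using miss[of i 0] m'(2) nonneg cF by (intro mult_right_mono) (auto intro: order_trans[OF divide_right_mono])
    also have "\<dots> \<le> weight m (miss_path n i (Suc i))"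
      using join[of i i "map (Dip n i) [0..<Suc (depth n i)]"] weight_shallow[OF m'(1), of i n] i
      by (simp add: miss_path_def c_def del: upt_Suc)
    finally show ?thesis .
  qed
  have 2: "miss_prob ?k / card F * e j \<le> weight m (miss_path n i' j)" if "j \<le> i" for j
  proof -
    have "miss_prob ?k \<le> p i' * ?r ^ Suc j" using that i by (intro miss) auto
    then have "miss_prob ?k / card F * e j \<le> p i' * ?r ^ Suc j / card F * e j"
      using nonneg by (intro mult_right_mono divide_right_mono) auto
    also have "\<dots> = p i' / card F * (?r ^ Suc j * e j)" by simp
    also have "\<dots> \<le> \<alpha> i' m' * (?r ^ Suc j * e j)"
      using m'(3) nonneg rate_power_bounds(1)[of ?k "Suc j"] by (intro mult_right_mono) (auto simp del: power_Suc)
    also have "\<dots> = \<alpha> i' m' * weight m' (ctrl_path n j @ [Risk n j] @ map (Dip n ?k) [0..<Suc (depth n ?k)])"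
      using weight_deep[OF m'(1), of j n] that i by (simp add: e_def)
    also have "\<dots> \<le> weight m (miss_path n i' j)"
      using join[of i' j "[Risk n j] @ map (Dip n ?k) [0..<Suc (depth n ?k)]"] that i
      by (simp add: miss_path_def del: upt_Suc)
    finally show ?thesis .
  qed
  let ?I = "insert (i, Suc i) (Pair i' ` {..i})"
  \<comment> \<open>Entering dip \<open>i\<close> is charged to level \<open>i\<close> and exits up
    to \<open>i\<close> to level \<open>i'\<close>. From the common mode these choices have total
    probability 1, so no part of the bound is lost.\<close>
  have "miss_prob ?k / card F = miss_prob ?k / card F * c + (\<Sum>j\<le>i. miss_prob ?k / card F * e j)"
    unfolding sum_distrib_left[symmetric] ec by (simp add: algebra_simps add_divide_distrib[symmetric])
  also have "\<dots> \<le> weight m (miss_path n i (Suc i)) + (\<Sum>j\<le>i. weight m (miss_path n i' j))"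
    using 1 2 by (intro add_mono sum_mono) auto
  also have "\<dots> = (\<Sum>(i, j)\<in>?I. weight m (miss_path n i j))"
    using i by (subst sum.insert) (auto simp: sum.reindex inj_on_def)
  also have "\<dots> \<le> (\<Sum>(i, j)\<in>miss_index ?k. weight m (miss_path n i j))"
    using i by (intro sum_mono2 finite_miss_index) (auto simp: miss_index_def history_prob_nonneg)
  finally show ?thesis .
qed

end

subsection \<open>Finite memory loses almost surely\<close>

lemma bad_sets: "bad n \<in> sets (run_measure delay_mdp s_init \<sigma>)"
  by (rule in_sets_run_measure) (simp add: bad_def)

lemma runs_sets: "runs delay_mdp s_init \<in> sets (run_measure delay_mdp s_init \<sigma>)"
proof (rule in_sets_run_measure)
  \<comment> \<open>Quantifying over the countably many values of both states leaves conditions on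
    single coordinates.\<close>
  have "Measurable.pred seq_algebra (\<lambda>\<rho> :: nat \<Rightarrow> nat. \<rho> 0 = s_init \<and>
      (\<forall>i. \<exists>s. \<rho> i = s \<and> (\<exists>t. \<rho> (Suc i) = t \<and> (s, t) \<in> edges delay_mdp)))"
    by measurable
  then show "Measurable.pred seq_algebra (\<lambda>\<rho>. \<rho> \<in> runs delay_mdp s_init)"
    by (simp add: runs_def)
qed

definition bad_free :: "nat \<Rightarrow> nat \<Rightarrow> (nat \<Rightarrow> nat) set" where
  "bad_free n0 N = {\<rho>\<in>runs delay_mdp s_init. \<forall>n. n0 \<le> n \<and> n < N \<longrightarrow> \<rho> \<notin> bad n}"

lemma bad_free_sets: "bad_free n0 N \<in> sets (run_measure delay_mdp s_init \<sigma>)"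
proof -
  have "bad_free n0 N = runs delay_mdp s_init - (\<Union>n\<in>{n0..<N}. bad n)" by (auto simp: bad_free_def)
  then show ?thesis using bad_sets runs_sets by auto
qed

context delay_memory
begin

context
  fixes m0 \<sigma>
  assumes m0: "m0 \<in> F" and \<sigma>: "\<sigma> \<in> strategies delay_mdp"
    and impl: "\<And>h s'. h \<in> partial_runs delay_mdp \<Longrightarrow> hd h = s_init \<Longrightarrow> last h \<in> controlled delay_mdp \<Longrightarrow>
      history_prob \<tau> m0 h > 0 \<Longrightarrow> pmf (\<sigma> h) s' = history_prob \<tau> m0 (h @ [s']) / history_prob \<tau> m0 h"
begin

lemmas prob_cylinder = prob_cylinder_eq_history_prob[OF m0 s_init_in_states impl]

text \<open>As an inequality this also covers lists that are not partial runs, whose chain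
  probability is 0. The miss paths then need not be shown to be partial runs.\<close>

lemma history_prob_le_prob_cylinder:
  assumes "h \<noteq> []" "hd h = s_init"
  shows "history_prob \<tau> m0 h \<le> run_prob delay_mdp s_init \<sigma> (cylinder h)"
proof (cases "h \<in> partial_runs delay_mdp")
  case True
  then show ?thesis using prob_cylinder[OF _ _ _ _ True assms(2)] by simp
next
  case False
  have "path_weight \<tau> m0 h m' = 0" for m'
    using memory_chain_support[OF mdp update m0 s_init_in_states, of h m'] False assms(2)
    by (auto simp: path_weight_def set_pmf_iff)
  then have "history_prob \<tau> m0 h = 0"
    using history_prob_eq[OF m0, of h] assms(2) s_init_in_states by simp
  then show ?thesis by (simp add: run_prob_def)
qed

text \<open>Averages \<open>sum_miss_weights\<close> over the mode reached after \<open>h\<close>.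
  The miss paths are disjoint events inside \<open>bad N\<close>, so their probabilities may be
  added.\<close>

lemma prob_bad_after_history:
  assumes card: "card F \<le> levels N"
    and h: "h \<in> partial_runs delay_mdp" "hd h = s_init" "last h = to_nat (Lev N 0)"
  shows "miss_prob (levels N) / card F * run_prob delay_mdp s_init \<sigma> (cylinder h) \<le>
    run_prob delay_mdp s_init \<sigma> (cylinder h \<inter> bad N)"
proof -
  let ?\<mu> = "run_measure delay_mdp s_init \<sigma>"
  let ?P = "run_prob delay_mdp s_init \<sigma>"
  let ?R = "runs delay_mdp s_init"
  let ?I = "miss_index (levels N)"
  interpret P: prob_space ?\<mu> by (rule prob_space_run_measure)
  have ne: "h \<noteq> []" using h(1) by (simp add: partial_runs_def)
  \<comment> \<open>A miss path starts with \<open>Lev N 0\<close> itself, so this last state of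
    \<open>h\<close> is removed before appending.\<close>
  define g where "g = butlast h"
  have hg: "h = g @ [to_nat (Lev N 0)]" using ne h(3) by (metis append_butlast_last_id g_def)
  define C where "C p = cylinder (g @ map to_nat (case p of (i, j) \<Rightarrow> miss_path N i j))" for p
  have C_sets: "C p \<in> sets ?\<mu>" for p by (simp add: C_def)
  have miss: "\<exists>q. miss_path N i j = Lev N 0 # q" for i j
    using lev_path_hd[of N i] by (auto simp: miss_path_def)
  \<comment> \<open>Intersecting with the runs costs only a null set; disjointness of the cylinders
    is known only there.\<close>
  have lower: "history_prob \<tau> m0 (g @ map to_nat (miss_path N i j)) \<le> ?P (C (i, j) \<inter> ?R)" for i j
  proof -
    have "history_prob \<tau> m0 (g @ map to_nat (miss_path N i j)) \<le> ?P (C (i, j))"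
      using miss[of i j] h(2) hg ne unfolding C_def prod.case
      by (intro history_prob_le_prob_cylinder) (auto simp: hd_append split: if_splits)
    also have "\<dots> = ?P (C (i, j) \<inter> ?R)"
      unfolding run_prob_def using AE_runs[OF mdp s_init_in_states \<sigma>]
      by (intro P.finite_measure_eq_AE) (auto intro: sets.Int runs_sets C_sets)
    finally show ?thesis .
  qed
  have "miss_prob (levels N) / card F * ?P (cylinder h) =
      (\<Sum>m\<in>F. path_weight \<tau> m0 h m * (miss_prob (levels N) / card F))"
    using prob_cylinder[OF _ _ _ _ h(1,2)] history_prob_eq[OF m0, of h] h(2) s_init_in_states
    by (simp add: sum_distrib_left sum_divide_distrib mult.commute)
  also have "\<dots> \<le> (\<Sum>m\<in>F. path_weight \<tau> m0 h m * (\<Sum>(i, j)\<in>?I. weight m (miss_path N i j)))"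
    using sum_miss_weights card by (intro sum_mono mult_left_mono) auto
  also have "\<dots> = (\<Sum>(i, j)\<in>?I. history_prob \<tau> m0 (g @ map to_nat (miss_path N i j)))"
  proof -
    have "history_prob \<tau> m0 (g @ map to_nat (miss_path N i j)) =
        (\<Sum>m\<in>F. path_weight \<tau> m0 h m * weight m (miss_path N i j))" for i j
    proof -
      obtain q where q: "miss_path N i j = Lev N 0 # q" using miss by blast
      have "history_prob \<tau> m0 (h @ map to_nat q) =
          (\<Sum>m\<in>F. path_weight \<tau> m0 h m * history_prob \<tau> m (last h # map to_nat q))"
        using ne h s_init_in_states m0 by (intro history_prob_append) (auto simp: states_delay_mdp)
      then show ?thesis by (simp add: q hg)
    qed
    then show ?thesis
      by (simp add: sum_distrib_left split_def) (rule sum.swap)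
  qed
  also have "\<dots> \<le> (\<Sum>p\<in>?I. ?P (C p \<inter> ?R))"
    using lower by (intro sum_mono) auto
  also have "\<dots> = ?P (\<Union>p\<in>?I. C p \<inter> ?R)"
    unfolding run_prob_def
  proof (rule P.finite_measure_finite_Union[symmetric])
    show "disjoint_family_on (\<lambda>p. C p \<inter> ?R) ?I"
    proof (unfold disjoint_family_on_def, intro ballI impI)
      fix p p' assume p: "p \<in> ?I" "p' \<in> ?I" "p \<noteq> p'"
      obtain i j i' j' where [simp]: "p = (i, j)" "p' = (i', j')" by (cases p, cases p')
      have "\<not> (\<rho> \<in> C p \<and> \<rho> \<in> C p' \<and> \<rho> \<in> ?R)" for \<rho>
        using miss_path_cylinders_disjoint[of _ g N i j i' j'] p
        by (auto simp: C_def miss_index_def runs_delay_mdp_iff)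
      then show "(C p \<inter> ?R) \<inter> (C p' \<inter> ?R) = {}" by blast
    qed
  qed (use finite_miss_index C_sets runs_sets in auto)
  also have "\<dots> \<le> ?P (cylinder h \<inter> bad N)"
    unfolding run_prob_def
  proof (rule P.finite_measure_mono)
    show "(\<Union>p\<in>?I. C p \<inter> ?R) \<subseteq> cylinder h \<inter> bad N"
    proof
      fix \<rho> assume "\<rho> \<in> (\<Union>p\<in>?I. C p \<inter> ?R)"
      then obtain i j where \<rho>: "\<rho> \<in> C (i, j)" "\<rho> \<in> ?R" by auto
      obtain q where q: "miss_path N i j = Lev N 0 # q" using miss by blast
      have "C (i, j) \<subseteq> cylinder h"
        using cylinder_append_subset[of h "map to_nat q"] by (simp add: C_def q hg)
      moreover have "\<rho> \<in> bad N"
        using \<rho> miss_path_bad by (auto simp: C_def runs_delay_mdp_iff)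
      ultimately show "\<rho> \<in> cylinder h \<inter> bad N" using \<rho>(1) by blast
    qed
  qed (use bad_sets in auto)
  finally show ?thesis .
qed

text \<open>Almost surely, \<open>bad_free n0 N\<close> is decided when the run reaches
  \<open>Lev N 0\<close>. So the bound of \<open>prob_bad_after_history\<close> for single histories
  carries over to it.\<close>

lemma prob_bad_free_Suc:
  assumes "n0 \<le> N" and card: "card F \<le> levels N"
  shows "run_prob delay_mdp s_init \<sigma> (bad_free n0 (Suc N)) \<le>
    (1 - miss_prob (levels N) / card F) * run_prob delay_mdp s_init \<sigma> (bad_free n0 N)"
proof -
  let ?\<mu> = "run_measure delay_mdp s_init \<sigma>"
  let ?P = "run_prob delay_mdp s_init \<sigma>"
  interpret P: prob_space ?\<mu> by (rule prob_space_run_measure)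
  define H where "H = {map \<rho> [0..<Suc t] |\<rho> t. \<rho> \<in> bad_free n0 N \<and> \<rho> t = to_nat (Lev N 0)}"
  define U where "U = (\<Union>h\<in>H. cylinder h)"
  have U_sets: "U \<in> sets ?\<mu>" unfolding U_def by (intro sets.countable_UN'') auto
  have sub: "bad_free n0 N \<subseteq> U"
  proof
    fix \<rho> assume \<rho>: "\<rho> \<in> bad_free n0 N"
    then obtain x where x: "node_run x" "\<rho> = (\<lambda>t. to_nat (x t))" by (auto simp: bad_free_def runs_delay_mdp_iff)
    obtain t where "x t = Lev N 0" using node_run_visits_stage[OF x(1)] by blast
    then have "\<rho> t = to_nat (Lev N 0)" by (simp add: x)
    then have "map \<rho> [0..<Suc t] \<in> H" using \<rho> unfolding H_def by blast
    moreover have "\<rho> \<in> cylinder (map \<rho> [0..<Suc t])" by (simp add: in_cylinder_iff del: upt_Suc)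
    ultimately show "\<rho> \<in> U" unfolding U_def by blast
  qed
  \<comment> \<open>Dips of stages before \<open>N\<close> precede \<open>Lev N 0\<close> and hence
    lie in the common prefix of both runs.\<close>
  have sup: "U \<inter> runs delay_mdp s_init \<subseteq> bad_free n0 N"
  proof
    fix \<rho> assume "\<rho> \<in> U \<inter> runs delay_mdp s_init"
    then obtain \<rho>' t where \<rho>: "\<rho> \<in> runs delay_mdp s_init" "\<rho> \<in> cylinder (map \<rho>' [0..<Suc t])"
      and \<rho>': "\<rho>' \<in> bad_free n0 N" "\<rho>' t = to_nat (Lev N 0)" by (auto simp: U_def H_def)
    have eq: "\<rho> u = \<rho>' u" if "u \<le> t" for u
      using \<rho>(2)[unfolded cylinder_def] that by (auto simp del: upt_Suc dest!: spec[of _ u])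
    obtain x where x: "node_run x" "\<rho> = (\<lambda>t. to_nat (x t))" using \<rho>(1) by (auto simp: runs_delay_mdp_iff)
    have xt: "x t = Lev N 0" using eq[of t] \<rho>'(2) x(2) by simp
    have "\<rho> \<notin> bad n" if n: "n0 \<le> n" "n < N" for n
    proof
      assume "\<rho> \<in> bad n"
      then obtain u i where u: "x u = Dip n i (depth n i)" "u \<le> 2 * depth n i" by (auto simp: bad_def x)
      have "u \<le> t" using node_run_stage_mono[OF x(1), of t u] xt u(1) n(2) by (cases "t \<le> u") auto
      then have "\<rho>' u = to_nat (Dip n i (depth n i))" using eq[of u] u(1) x(2) by simp
      then have "\<rho>' \<in> bad n" using u(2) by (auto simp: bad_def)
      then show False using \<rho>'(1) n by (auto simp: bad_free_def)
    qed
    then show "\<rho> \<in> bad_free n0 N" using \<rho>(1) by (simp add: bad_free_def)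
  qed
  have AE: "AE \<rho> in ?\<mu>. \<rho> \<in> U \<longleftrightarrow> \<rho> \<in> bad_free n0 N"
    using AE_runs[OF mdp s_init_in_states \<sigma>]
  proof eventually_elim
    case (elim \<rho>)
    then show ?case using sub sup by blast
  qed
  have PU: "?P U = ?P (bad_free n0 N)"
    unfolding run_prob_def using AE by (intro P.finite_measure_eq_AE) (auto intro: U_sets bad_free_sets)
  have PUb: "?P (U \<inter> bad N) = ?P (bad_free n0 N \<inter> bad N)"
    unfolding run_prob_def using AE
    by (intro P.finite_measure_eq_AE) (auto intro: sets.Int U_sets bad_free_sets bad_sets)
  have "miss_prob (levels N) / card F * ?P (\<Union>h\<in>H. cylinder h) \<le> ?P ((\<Union>h\<in>H. cylinder h) \<inter> bad N)"
  proof (rule cylinder_union_ge[OF _ bad_sets])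
    show "disjoint_family_on cylinder H"
    proof (rule disjoint_cylinders_last_visit[where s = "to_nat (Lev N 0)"])
      fix h assume "h \<in> H"
      then obtain \<rho> t where h: "h = map \<rho> [0..<Suc t]" "\<rho> \<in> bad_free n0 N" "\<rho> t = to_nat (Lev N 0)"
        by (auto simp: H_def)
      then obtain x where x: "node_run x" "\<rho> = (\<lambda>t. to_nat (x t))" by (auto simp: bad_free_def runs_delay_mdp_iff)
      have "to_nat (Lev N 0) \<noteq> \<rho> u" if "u < t" for u
        using node_run_inj[OF x(1), of u t] that h(3) x(2) by auto
      then show "h \<noteq> [] \<and> last h = to_nat (Lev N 0) \<and> to_nat (Lev N 0) \<notin> set (butlast h)"
        using h(3) by (simp add: h(1) image_iff)
    qed
    show "0 \<le> miss_prob (levels N) / card F" using miss_prob_pos[of "levels N"] by (simp add: less_imp_le)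
    fix h assume "h \<in> H"
    then obtain \<rho> t where h: "h = map \<rho> [0..<Suc t]" "\<rho> \<in> bad_free n0 N" "\<rho> t = to_nat (Lev N 0)"
      by (auto simp: H_def)
    have r: "\<rho> \<in> runs delay_mdp s_init" using h(2) by (simp add: bad_free_def)
    show "miss_prob (levels N) / card F * ?P (cylinder h) \<le> ?P (cylinder h \<inter> bad N)"
    proof (rule prob_bad_after_history[OF card])
      show "h \<in> partial_runs delay_mdp" unfolding h(1) by (rule prefix_partial_run[OF r mdp])
      show "hd h = s_init" using r by (simp add: h(1) runs_def upt_conv_Cons del: upt_Suc)
      show "last h = to_nat (Lev N 0)" using h(3) by (simp add: h(1))
    qed
  qed
  then have b: "miss_prob (levels N) / card F * ?P (bad_free n0 N) \<le> ?P (bad_free n0 N \<inter> bad N)"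
    using PU PUb by (simp add: U_def)
  have "bad_free n0 (Suc N) = bad_free n0 N - (bad_free n0 N \<inter> bad N)"
    using assms(1) by (auto simp: bad_free_def less_Suc_eq)
  then have "?P (bad_free n0 (Suc N)) = ?P (bad_free n0 N) - ?P (bad_free n0 N \<inter> bad N)"
    unfolding run_prob_def using bad_free_sets bad_sets by (simp add: P.finite_measure_Diff sets.Int)
  then show ?thesis using b by (simp add: algebra_simps)
qed

text \<open>Takes the place of independence in the second Borel--Cantelli lemma. If the event had
  probability \<delta> > 0, each late stage would take at least \<delta> times
  \<open>miss_prob / card F\<close> from the probability of \<open>bad_free\<close>, and these
  losses have an infinite sum.\<close>

lemma prob_finitely_many_bad:
  "run_prob delay_mdp s_init \<sigma> {\<rho>\<in>runs delay_mdp s_init. \<forall>n\<ge>n0. \<rho> \<notin> bad n} = 0"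
proof -
  let ?\<mu> = "run_measure delay_mdp s_init \<sigma>"
  let ?P = "run_prob delay_mdp s_init \<sigma>"
  interpret P: prob_space ?\<mu> by (rule prob_space_run_measure)
  define \<delta> where "\<delta> = ?P {\<rho>\<in>runs delay_mdp s_init. \<forall>n\<ge>n0. \<rho> \<notin> bad n}"
  \<comment> \<open>From this stage on \<open>levels\<close> is at least \<open>card F\<close>; as
    levels start at 0, there are more of them than modes.\<close>
  define n1 where "n1 = max n0 (block_start (card F))"
  have cF: "0 < card F" using m0 finite_F by (auto simp: card_gt_0_iff)
  have \<delta>: "\<delta> \<le> ?P (bad_free n0 N)" for N
    unfolding \<delta>_def run_prob_def by (intro P.finite_measure_mono bad_free_sets) (auto simp: bad_free_def)
  have "\<delta> / card F * (\<Sum>i<K. miss_prob (levels (i + n1))) + ?P (bad_free n0 (K + n1)) \<le> 1" for K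
  proof (induction K)
    case 0
    then show ?case by (simp add: run_prob_def)
  next
    case (Suc K)
    let ?m = "miss_prob (levels (K + n1))"
    have "?P (bad_free n0 (Suc (K + n1))) \<le> (1 - ?m / card F) * ?P (bad_free n0 (K + n1))"
      by (rule prob_bad_free_Suc) (auto simp: n1_def intro: levels_ge)
    moreover have "?m / card F * \<delta> \<le> ?m / card F * ?P (bad_free n0 (K + n1))"
      using \<delta> miss_prob_pos[of "levels (K + n1)"] by (intro mult_left_mono) (auto simp: less_imp_le)
    ultimately show ?case using Suc by (simp add: algebra_simps)
  qed
  moreover have "0 \<le> ?P A" for A by (simp add: run_prob_def)
  ultimately have le: "\<delta> / card F * (\<Sum>i<K. miss_prob (levels (i + n1))) \<le> 1" for K
    by (meson add_increasing2 le_add_same_cancel1 order_trans)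
  have "\<not> 0 < \<delta>"
  proof
    assume pos: "0 < \<delta>"
    have "summable (\<lambda>i. miss_prob (levels (i + n1)))"
    proof (rule summableI_nonneg_bounded)
      show "0 \<le> miss_prob (levels (i + n1))" for i by (rule less_imp_le[OF miss_prob_pos])
      show "(\<Sum>i<K. miss_prob (levels (i + n1))) \<le> card F / \<delta>" for K
        using le[of K] pos cF by (simp add: field_simps)
    qed
    then show False
      using not_summable_miss_prob summable_iff_shift[of "\<lambda>n. miss_prob (levels n)" n1] by blast
  qed
  moreover have "0 \<le> \<delta>" by (simp add: \<delta>_def run_prob_def)
  ultimately show ?thesis by (simp add: \<delta>_def)
qed

lemma prob_MP_eq_0: "run_prob delay_mdp s_init \<sigma> (MP_liminf_ge_0 delay_mdp s_init) = 0"
proof -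
  let ?\<mu> = "run_measure delay_mdp s_init \<sigma>"
  interpret P: prob_space ?\<mu> by (rule prob_space_run_measure)
  let ?T = "\<lambda>n0. {\<rho>\<in>runs delay_mdp s_init. \<forall>n\<ge>n0. \<rho> \<notin> bad n}"
  have T: "?T n0 \<in> sets ?\<mu>" for n0
  proof -
    have "?T n0 = runs delay_mdp s_init - (\<Union>n\<in>{n0..}. bad n)" by auto
    then show ?thesis using bad_sets runs_sets by auto
  qed
  have "?T n0 \<in> null_sets ?\<mu>" for n0
  proof (rule null_setsI)
    show "emeasure ?\<mu> (?T n0) = 0"
      unfolding P.emeasure_eq_measure prob_finitely_many_bad[unfolded run_prob_def] by (rule ennreal_0)
  qed (rule T)
  then have "(\<Union>n0. ?T n0) \<in> null_sets ?\<mu>" by (intro null_sets_UN)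
  then have "MP_liminf_ge_0 delay_mdp s_init \<in> null_sets ?\<mu>"
  proof (rule null_sets_subset[OF _ MP_liminf_ge_0_measurable])
    show "MP_liminf_ge_0 delay_mdp s_init \<subseteq> (\<Union>n0. ?T n0)"
      using MP_finitely_many_bad by (auto simp: MP_liminf_ge_0_def)
  qed
  then show ?thesis by (simp add: run_prob_def measure_eq_0_null_sets)
qed

end

end

lemma FR_prob_MP_eq_0:
  assumes "\<sigma> \<in> FR_strategies delay_mdp"
  shows "run_prob delay_mdp s_init \<sigma> (MP_liminf_ge_0 delay_mdp s_init) = 0"
proof -
  obtain F :: "nat set" and m0 \<tau> where *: "finite F" "m0 \<in> F" "memory_update delay_mdp F \<tau>"
    "implements delay_mdp \<tau> m0 \<sigma>" "\<sigma> \<in> strategies delay_mdp"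
    using assms by (auto simp: FR_strategies_def)
  interpret delay_memory F \<tau> by unfold_locales (use * mdp_delay_mdp in auto)
  show ?thesis by (rule prob_MP_eq_0[OF *(2,5)]) (use *(4) in \<open>auto simp: implements_def\<close>)
qed

text \<open>The counter can be recomputed from the potential of the state, so on histories from
  \<open>s_init\<close> the strategy is implemented by a chain with finitely many modes.\<close>

lemma reward_counter_prob_MP_eq_0:
  assumes "\<sigma> \<in> reward_counter_FR_strategies delay_mdp"
  shows "run_prob delay_mdp s_init \<sigma> (MP_liminf_ge_0 delay_mdp s_init) = 0"
proof -
  obtain F :: "nat set" and m0 \<tau> where *: "finite F" "m0 \<in> F"
    "memory_update delay_mdp (F \<times> (UNIV :: real set)) \<tau>"
    "\<forall>m\<in>F. \<forall>c. \<forall>s\<in>states delay_mdp. \<forall>((m', c'), s')\<in>set_pmf (\<tau> (m, c) s). c' = c + reward delay_mdp s s'"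
    "implements delay_mdp \<tau> (m0, 0) \<sigma>" "\<sigma> \<in> strategies delay_mdp"
    using assms unfolding reward_counter_FR_strategies_def by blast
  define pot where "pot s = potential (from_nat s)" for s
  define \<tau>' where "\<tau>' m s = map_pmf (\<lambda>((m', c'), s'). (m', s')) (\<tau> (m, pot s) s)" for m s
  have pot: "reward delay_mdp s t = pot t - pot s" for s t by (simp add: pot_def reward_delay_mdp)
  have pot0: "pot s_init = 0" by (simp add: pot_def s_init_def)
  note forget = memory_chain_forget_counter[OF mdp_delay_mdp s_init_in_states *(1,2,3,4) pot pot0 \<tau>'_def]
  interpret delay_memory F \<tau>' by unfold_locales (use *(1) mdp_delay_mdp forget(1) in auto)
  show ?thesis
  proof (rule prob_MP_eq_0[OF *(2,6)])
    fix h s' assume h: "h \<in> partial_runs delay_mdp" "hd h = s_init" "last h \<in> controlled delay_mdp"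
      "history_prob \<tau>' m0 h > 0"
    have "h \<noteq> []" using h(1) by (simp add: partial_runs_def)
    then have "history_prob \<tau>' m0 h = history_prob \<tau> (m0, 0) h"
      "history_prob \<tau>' m0 (h @ [s']) = history_prob \<tau> (m0, 0) (h @ [s'])"
      using forget(2)[of h] forget(2)[of "h @ [s']"] h(2) by simp_all
    then show "pmf (\<sigma> h) s' = history_prob \<tau>' m0 (h @ [s']) / history_prob \<tau>' m0 h"
      using *(5) h by (simp add: implements_def)
  qed
qed

theorem theorem6p10:
  shows "\<exists>(M :: nat mdp) s0.
    mdp M \<and> s0 \<in> states M \<and>
    acyclic (edges M) \<and>
    implicit_total_reward M s0 \<and>
    (\<forall>s\<in>random_states M. \<forall>t. pmf (succ_dist M s) t \<in> \<rat>) \<and>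
    (\<forall>(s, t)\<in>edges M. reward M s t \<in> {-1, 0, 1}) \<and>
    (\<forall>s\<in>states M. finite (successors M s) \<and> card (successors M s) \<le> 2) \<and>
    val M s0 (MP_liminf_ge_0 M s0) = 1 \<and>
    (\<forall>\<sigma>\<in>FR_strategies M. run_prob M s0 \<sigma> (MP_liminf_ge_0 M s0) = 0) \<and>
    (\<forall>\<epsilon><1. \<not> (\<exists>\<sigma>\<in>reward_counter_FR_strategies M.
        eps_optimal M s0 (MP_liminf_ge_0 M s0) \<epsilon> \<sigma>))"
proof (intro exI[of _ delay_mdp] exI[of _ s_init] conjI ballI allI impI notI)
  show "case e of (s, t) \<Rightarrow> reward delay_mdp s t \<in> {-1, 0, 1}" if "e \<in> edges delay_mdp" for e
    using that step_potential by (force simp: edge_iff reward_delay_mdp split: prod.splits)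
  show False if "\<epsilon> < 1" "\<exists>\<sigma>\<in>reward_counter_FR_strategies delay_mdp.
      eps_optimal delay_mdp s_init (MP_liminf_ge_0 delay_mdp s_init) \<epsilon> \<sigma>" for \<epsilon>
    \<comment> \<open>With value 1 and winning probability 0, optimality up to \<epsilon> would mean
      \<open>0 \<ge> 1 - \<epsilon>\<close>.\<close>
    using that reward_counter_prob_MP_eq_0 by (auto simp: eps_optimal_def val_delay_mdp)
qed (use mdp_delay_mdp s_init_in_states acyclic_delay_mdp implicit_total_reward_delay_mdp
    rational_delay_mdp successors_delay_mdp val_delay_mdp FR_prob_MP_eq_0 in auto)

end
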